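(* Let $N'\ge1$ be an integer and let $(g_{\mathfrak b},h_{\mathfrak b})$, $\mathfrak b>0$, be Yang's family of $S^1$-symmetric Einstein-Bogomol'nyi metrics on $\mathbf{P}^1$ with Higgs field $\boldsymbol\phi=z_0^{N'}z_1^{N'}\in H^0(\mathcal{O}_{\mathbf{P}^1}(2N'))$. As $\mathfrak b\to+\infty$: (i) the metric $g_{\mathfrak b}$ converges, smoothly on compact subsets of $\mathbf{P}^1\setminus\{0,\infty\}$, to the round metric on $\mathbf{P}^1$ with K\"ahler form $4N'\omega_0$; (ii) the state function $|\boldsymbol\phi|_{h_{\mathfrak b}}^2$ converges to $0$ uniformly on $\mathbf{P}^1$; (iii) the rescaled Hermitian metric $\left(\max_{\mathbf{P}^1}|\boldsymbol\phi|_{h_{\mathfrak b}}^2\right)^{-1}h_{\mathfrak b}$ converges, smoothly on compact subsets of $\mathbf{P}^1\setminus\{0,\infty\}$, to a Hermitian metric of constant curvature on $\mathcal{O}_{\mathbf{P}^1}(2N')$ (one whose curvature form $iF$ equals $2N'\omega_0$).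
   Context: Here $\tau=1$, $N=2N'$, $\alpha=\frac1{2N'}$, and $\omega_0=\frac{i\,dz\wedge d\bar z}{(1+|z|^2)^2}$. On $\mathbf{C}^*\subset\mathbf{P}^1$ use the coordinates $z=re^{i\theta}$, $r=e^t$, $(t,\theta)\in\mathbf{R}\times S^1$; in the standard trivialization over $\mathbf{C}$ the section $\boldsymbol\phi$ is $z^{N'}$. For each $\mathfrak b>0$ let $\lambda_{\mathfrak b}=\frac{1}{2N'e^{2\alpha(\mathfrak b+e^{-\mathfrak b})}}$ and let $u^{\mathfrak b}:\mathbf{R}\to\mathbf{R}$ be the global solution of $$u_{tt}=\frac1{\lambda_{\mathfrak b}}e^{2\alpha(u-e^u)}(e^u-1),\qquad u(0)=-\mathfrak b,\quad u_t(0)=0,$$ which satisfies $\lim_{t\to\pm\infty}u_t(t)=\mp2N'$ (Yang). Define $h_{\mathfrak b}$ by $|\boldsymbol\phi|_{h_{\mathfrak b}}^2=e^{u^{\mathfrak b}(t)}$, i.e. $h_{\mathfrak b}=e^{u^{\mathfrak b}(\log|z|)}/|z|^{2N'}$ in the standard trivialization over $\mathbf{C}$, and $g_{\mathfrak b}=\frac1{\lambda_{\mathfrak b}}e^{2\alpha(u^{\mathfrak b}-e^{u^{\mathfrak b}})}(dt^2+d\theta^2)$; both extend smoothly to $\mathbf{P}^1$ and, with $\omega_{\mathfrak b}$ the K\"ahler form of $g_{\mathfrak b}$, form an Einstein-Bogomol'nyi metric, i.e. solve $iF_h+\frac12(|\boldsymbol\phi|_h^2-1)\omega=0$, $S_\omega+\alpha(\Delta_\omega+1)(|\boldsymbol\phi|_h^2-1)=0$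 with $F_h=-\partial\bar\partial\log h$, $\Delta_\omega\eta=\mathrm{tr}_\omega(-2i\partial\bar\partial\eta)$, $S_\omega=\mathrm{tr}_\omega\mathrm{Ric}\,\omega$. *)

theory Defs
  imports "HOL-Analysis.Analysis"
begin

section \<open>The complex projective line\<close>

type_synonym vec2 = "complex \<times> complex"

definition cscale :: "complex \<Rightarrow> vec2 \<Rightarrow> vec2" where
  "cscale c Z = (c * fst Z, c * snd Z)"

definition proj_rel :: "vec2 \<Rightarrow> vec2 \<Rightarrow> bool" where
  "proj_rel Z W \<longleftrightarrow> Z \<noteq> 0 \<and> (\<exists>c. c \<noteq> 0 \<and> W = cscale c Z)"

lemma part_equivp_proj_rel: "part_equivp proj_rel"
proof (rule part_equivpI)
  show "\<exists>Z. proj_rel Z Z"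
    by (rule exI[of _ "(1, 1)"], unfold proj_rel_def cscale_def) (auto simp: zero_prod_def)
  show "symp proj_rel"
  proof (rule sympI)
    fix Z W assume "proj_rel Z W"
    then obtain c where c: "Z \<noteq> 0" "c \<noteq> 0" "W = cscale c Z"
      by (auto simp: proj_rel_def)
    then have "W \<noteq> 0" "Z = cscale (inverse c) W"
      by (auto simp: cscale_def zero_prod_def prod_eq_iff)
    with c show "proj_rel W Z"
      unfolding proj_rel_def by (metis inverse_nonzero_iff_nonzero)
  qed
  show "transp proj_rel"
  proof (rule transpI)
    fix X Y Z assume "proj_rel X Y" "proj_rel Y Z"
    then obtain c d where "X \<noteq> 0" "c \<noteq> 0" "d \<noteq> 0" "Z = cscale d (cscale c X)"
      by (auto simp: proj_rel_def)
    then show "proj_rel X Z"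
      unfolding proj_rel_def
      by (intro conjI exI[of _ "d * c"]) (auto simp: cscale_def)
  qed
qed

quotient_type cp1 = "vec2" / partial: proj_rel
  by (rule part_equivp_proj_rel)

text \<open>The class of a nonzero vector in homogeneous coordinates; \<^term>\<open>proj 0\<close> is meaningless.\<close>

abbreviation proj :: "vec2 \<Rightarrow> cp1" where
  "proj \<equiv> abs_cp1"

text \<open>Quotient topology.\<close>

instantiation cp1 :: topological_space
begin

definition open_cp1 :: "cp1 set \<Rightarrow> bool" where
  "open_cp1 U \<longleftrightarrow> open {Z. Z \<noteq> 0 \<and> proj Z \<in> U}"

instance
proof
  have "{Z :: vec2. Z \<noteq> 0 \<and> proj Z \<in> UNIV} = - {0}" by auto
  then show "open (UNIV :: cp1 set)"
    unfolding open_cp1_def by (simp add: open_Compl)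
next
  fix S T :: "cp1 set" assume "open S" "open T"
  moreover have "{Z. Z \<noteq> 0 \<and> proj Z \<in> S \<inter> T} =
      {Z. Z \<noteq> 0 \<and> proj Z \<in> S} \<inter> {Z. Z \<noteq> 0 \<and> proj Z \<in> T}" by auto
  ultimately show "open (S \<inter> T)"
    unfolding open_cp1_def by (simp only: open_Int)
next
  fix K :: "cp1 set set" assume "\<forall>S\<in>K. open S"
  moreover have "{Z. Z \<noteq> 0 \<and> proj Z \<in> \<Union>K} = (\<Union>S\<in>K. {Z. Z \<noteq> 0 \<and> proj Z \<in> S})" by auto
  ultimately show "open (\<Union>K)"
    unfolding open_cp1_def by (simp only:) (rule open_UN, blast)
qed

end

text \<open>
  The two affine charts: \<open>U0\<close> has coordinate \<open>z = z\<^sub>1/z\<^sub>0\<close> and \<open>U1\<close> has coordinate \<open>w = z\<^sub>0/z\<^sub>1\<close>.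
  The inverse of each chart is lifted to \<open>\<complex>\<^sup>2 \<setminus> {0}\<close>, and \<open>dlift\<close> is the derivative of the lift.
\<close>

datatype chart = U0 | U1

fun lift :: "chart \<Rightarrow> complex \<Rightarrow> vec2" where
  "lift U0 z = (1, z)"
| "lift U1 w = (w, 1)"

fun dlift :: "chart \<Rightarrow> complex \<Rightarrow> vec2" where
  "dlift U0 v = (0, v)"
| "dlift U1 v = (v, 0)"

abbreviation pt_zero :: cp1 where "pt_zero \<equiv> proj (lift U0 0)"
abbreviation pt_infinity :: cp1 where "pt_infinity \<equiv> proj (lift U1 0)"


section \<open>Smooth functions and smooth convergence\<close>

text \<open>Iterated directional derivatives of a function on the real plane \<open>\<complex>\<close>.\<close>

fun iter_deriv :: "complex list \<Rightarrow> (complex \<Rightarrow> real) \<Rightarrow> complex \<Rightarrow> real" where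
  "iter_deriv [] f = f"
| "iter_deriv (v # vs) f = (\<lambda>z. frechet_derivative (iter_deriv vs f) (at z) v)"

definition smooth_fun :: "(complex \<Rightarrow> real) \<Rightarrow> bool" where
  "smooth_fun f \<longleftrightarrow> (\<forall>vs z. iter_deriv vs f differentiable (at z))"

definition smooth_limit_on ::
    "complex set \<Rightarrow> (real \<Rightarrow> complex \<Rightarrow> real) \<Rightarrow> (complex \<Rightarrow> real) \<Rightarrow> real filter \<Rightarrow> bool" where
  "smooth_limit_on K f l F \<longleftrightarrow>
     (\<forall>vs. uniform_limit K (\<lambda>b. iter_deriv vs (f b)) (iter_deriv vs l) F)"


section \<open>Covariant 2-tensors on the projective line\<close>

text \<open>
  A covariant 2-tensor field on \<open>P\<^sup>1\<close> is represented by its pullback \<open>\<tau>\<close> along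
  \<open>\<complex>\<^sup>2 \<setminus> {0} \<rightarrow> P\<^sup>1\<close>: \<open>\<tau> Z V W\<close> is its value at \<open>[Z]\<close> on the images of the tangent
  vectors \<open>V\<close>, \<open>W\<close> at \<open>Z\<close>. The tensors that arise in this way are the basic ones.
\<close>

type_synonym tensor2 = "vec2 \<Rightarrow> vec2 \<Rightarrow> vec2 \<Rightarrow> real"

definition basic_tensor :: "tensor2 \<Rightarrow> bool" where
  "basic_tensor \<tau> \<longleftrightarrow>
     (\<forall>Z V W c a b. Z \<noteq> 0 \<longrightarrow> c \<noteq> 0 \<longrightarrow>
        \<tau> (cscale c Z) (cscale c V + cscale a Z) (cscale c W + cscale b Z) = \<tau> Z V W)"

definition local_tensor :: "tensor2 \<Rightarrow> chart \<Rightarrow> complex \<Rightarrow> complex \<Rightarrow> complex \<Rightarrow> real" where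
  "local_tensor \<tau> c z v w = \<tau> (lift c z) (dlift c v) (dlift c w)"

definition riemannian_metric :: "tensor2 \<Rightarrow> bool" where
  "riemannian_metric g \<longleftrightarrow> basic_tensor g \<and>
     (\<forall>c z. bilinear (local_tensor g c z) \<and>
            (\<forall>v w. local_tensor g c z v w = local_tensor g c z w v) \<and>
            (\<forall>v. v \<noteq> 0 \<longrightarrow> local_tensor g c z v v > 0)) \<and>
     (\<forall>c v w. smooth_fun (\<lambda>z. local_tensor g c z v w))"

text \<open>\<open>\<omega>(v, w) = g(Jv, w)\<close>; thus \<open>\<rho> (dx\<^sup>2 + dy\<^sup>2)\<close> has the form \<open>\<rho> dx \<and> dy = \<rho> (i/2) dz \<and> d(cnj z)\<close>.\<close>

definition kaehler_form :: "tensor2 \<Rightarrow> chart \<Rightarrow> complex \<Rightarrow> complex \<Rightarrow> complex \<Rightarrow> real" where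
  "kaehler_form g c z v w = local_tensor g c z (\<i> * v) w"

definition dz_dzbar :: "complex \<Rightarrow> complex \<Rightarrow> complex" where
  "dz_dzbar v w = v * cnj w - w * cnj v"

text \<open>The form \<open>\<omega>\<^sub>0\<close>; its expression is the same in both charts.\<close>

definition omega0 :: "complex \<Rightarrow> complex \<Rightarrow> complex \<Rightarrow> complex" where
  "omega0 z v w = \<i> * dz_dzbar v w / of_real ((1 + (cmod z)\<^sup>2)\<^sup>2)"

text \<open>Compact sets avoiding both poles lie in the chart \<open>U0\<close>, so convergence is tested there.\<close>

definition metrics_converge_off_poles :: "(real \<Rightarrow> tensor2) \<Rightarrow> tensor2 \<Rightarrow> real filter \<Rightarrow> bool" where
  "metrics_converge_off_poles g g' F \<longleftrightarrow>
     (\<forall>K. compact K \<and> K \<subseteq> - {pt_zero, pt_infinity} \<longrightarrow>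
        (\<forall>v w. smooth_limit_on {z. proj (lift U0 z) \<in> K}
                 (\<lambda>b z. local_tensor (g b) U0 z v w) (\<lambda>z. local_tensor g' U0 z v w) F))"


section \<open>Hermitian metrics on the line bundles \<open>O(k)\<close>\<close>

text \<open>
  The fibre of \<open>O(k)\<close> over \<open>[Z]\<close> consists of the functions on \<open>\<complex>Z\<close> that are homogeneous
  of degree \<open>k\<close>. A Hermitian metric is represented by the function \<open>H\<close> for which \<open>H Z\<close>
  is the squared norm of the fibre element with value 1 at \<open>Z\<close>, so that
  \<open>\<bar>s\<bar>\<^sup>2([Z]) = \<bar>s Z\<bar>\<^sup>2 H Z\<close>. In the trivializations by \<open>z\<^sub>0\<^sup>k\<close> and \<open>z\<^sub>1\<^sup>k\<close> it is given
  by the weights \<open>H (1, z)\<close> and \<open>H (w, 1)\<close>.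
\<close>

type_synonym bundle_metric = "vec2 \<Rightarrow> real"

definition local_weight :: "bundle_metric \<Rightarrow> chart \<Rightarrow> complex \<Rightarrow> real" where
  "local_weight H c z = H (lift c z)"

definition hermitian_metric :: "nat \<Rightarrow> bundle_metric \<Rightarrow> bool" where
  "hermitian_metric k H \<longleftrightarrow>
     (\<forall>Z. Z \<noteq> 0 \<longrightarrow> H Z > 0) \<and>
     (\<forall>Z c. Z \<noteq> 0 \<longrightarrow> c \<noteq> 0 \<longrightarrow> H (cscale c Z) * cmod c ^ (2 * k) = H Z) \<and>
     (\<forall>c. smooth_fun (local_weight H c))"

definition norm_sq :: "bundle_metric \<Rightarrow> (vec2 \<Rightarrow> complex) \<Rightarrow> cp1 \<Rightarrow> real" where
  "norm_sq H s p = (cmod (s (rep_cp1 p)))\<^sup>2 * H (rep_cp1 p)"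

text \<open>In a chart, \<open>\<partial> d-bar f\<close> is \<open>(d_z (d_zbar f)) dz \<and> d(cnj z)\<close>, and \<open>F = - \<partial> d-bar log h\<close>.\<close>

definition d_z :: "(complex \<Rightarrow> complex) \<Rightarrow> complex \<Rightarrow> complex" where
  "d_z f z = (frechet_derivative f (at z) 1 - \<i> * frechet_derivative f (at z) \<i>) / 2"

definition d_zbar :: "(complex \<Rightarrow> complex) \<Rightarrow> complex \<Rightarrow> complex" where
  "d_zbar f z = (frechet_derivative f (at z) 1 + \<i> * frechet_derivative f (at z) \<i>) / 2"

definition curvature_form ::
    "bundle_metric \<Rightarrow> chart \<Rightarrow> complex \<Rightarrow> complex \<Rightarrow> complex \<Rightarrow> complex" where
  "curvature_form H c z v w =
     - d_z (d_zbar (\<lambda>\<zeta>. of_real (ln (local_weight H c \<zeta>)))) z * dz_dzbar v w"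

definition bundle_metrics_converge_off_poles ::
    "(real \<Rightarrow> bundle_metric) \<Rightarrow> bundle_metric \<Rightarrow> real filter \<Rightarrow> bool" where
  "bundle_metrics_converge_off_poles H H' F \<longleftrightarrow>
     (\<forall>K. compact K \<and> K \<subseteq> - {pt_zero, pt_infinity} \<longrightarrow>
        smooth_limit_on {z. proj (lift U0 z) \<in> K}
          (\<lambda>b. local_weight (H b) U0) (local_weight H' U0) F)"


section \<open>Yang's family\<close>

definition higgs :: "nat \<Rightarrow> vec2 \<Rightarrow> complex" where
  "higgs N Z = fst Z ^ N * snd Z ^ N"

definition coupling :: "nat \<Rightarrow> real" where
  "coupling N = 1 / (2 * real N)"

definition yang_lambda :: "nat \<Rightarrow> real \<Rightarrow> real" where
  "yang_lambda N b = 1 / (2 * real N * exp (2 * coupling N * (b + exp (- b))))"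

definition conf_factor :: "nat \<Rightarrow> real \<Rightarrow> real \<Rightarrow> real" where
  "conf_factor N b x = 1 / yang_lambda N b * exp (2 * coupling N * (x - exp x))"

definition yang_solution :: "nat \<Rightarrow> real \<Rightarrow> (real \<Rightarrow> real) \<Rightarrow> bool" where
  "yang_solution N b u \<longleftrightarrow>
     (\<exists>u'. (\<forall>t. (u has_real_derivative u' t) (at t)) \<and>
           (\<forall>t. (u' has_real_derivative conf_factor N b (u t) * (exp (u t) - 1)) (at t)) \<and>
           u 0 = - b \<and> u' 0 = 0)"

text \<open>The 1-forms \<open>dt\<close> and \<open>d\<theta>\<close> on \<open>\<complex>\<^sup>*\<close>: from \<open>z = exp (t + i \<theta>)\<close>, \<open>dz/z = dt + i d\<theta>\<close>.\<close>

definition dt_form :: "complex \<Rightarrow> complex \<Rightarrow> real" where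
  "dt_form z v = Re (v / z)"

definition dtheta_form :: "complex \<Rightarrow> complex \<Rightarrow> real" where
  "dtheta_form z v = Im (v / z)"

text \<open>
  The formulas below fix the metrics on \<open>\<complex>\<^sup>*\<close>, hence everywhere: the smooth extensions over the
  poles are unique. That \<open>u\<^sub>t\<close> tends to \<open>\<mp>2N\<close> and that the pair solves the
  Einstein-Bogomol'nyi equations follows from these data and is not required separately.
\<close>

definition yang_metric :: "nat \<Rightarrow> real \<Rightarrow> (real \<Rightarrow> real) \<Rightarrow> tensor2 \<Rightarrow> bool" where
  "yang_metric N b u g \<longleftrightarrow> riemannian_metric g \<and>
     (\<forall>z v w. z \<noteq> 0 \<longrightarrow> local_tensor g U0 z v w =
        conf_factor N b (u (ln (cmod z))) *
          (dt_form z v * dt_form z w + dtheta_form z v * dtheta_form z w))"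

definition yang_hermitian :: "nat \<Rightarrow> (real \<Rightarrow> real) \<Rightarrow> bundle_metric \<Rightarrow> bool" where
  "yang_hermitian N u H \<longleftrightarrow> hermitian_metric (2 * N) H \<and>
     (\<forall>z. z \<noteq> 0 \<longrightarrow> local_weight H U0 z = exp (u (ln (cmod z))) / cmod z ^ (2 * N))"

end

theory Submission
  imports Defs
begin

text \<open>
  Everything depends on \<open>z\<close> through \<open>t = ln \<bar>z\<bar>\<close>, so the theorem is about a family of ordinary
  differential equations. A conserved energy forces \<open>u \<le> - b\<close> (\<open>yang_solution_le\<close>), hence the state
  function \<open>exp u\<close> has maximum \<open>exp (- b)\<close>, attained on the circle \<open>\<bar>z\<bar> = 1\<close>; this is part (ii),
  and it identifies the normalizing constant of part (iii).

  Put \<open>\<epsilon> = exp (- b)\<close> and \<open>w = u + b\<close>. Then \<open>w \<le> 0\<close>, the initial data are \<open>w(0) = w'(0) = 0\<close>, and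
  the equation becomes \<open>w'' = Q (\<epsilon> exp w - 1)\<close> with conformal factor
  \<open>Q = 2 N exp ((w + \<epsilon> (1 - exp w)) / N)\<close>. On \<open>w \<le> 0\<close> this is an \<open>O(\<epsilon>)\<close> perturbation of the
  Liouville equation \<open>w'' = - 2 N exp (w / N)\<close>, whose solution with the same initial data is
  \<open>- 2 N ln (cosh t)\<close>. A Gronwall estimate (\<open>second_order_stability\<close>) gives convergence of \<open>w\<close>
  and \<open>w'\<close>, uniformly on compact intervals (\<open>yang_solution_near_limit\<close>).

  Derivatives of all orders come for free: the functions \<open>E = exp w\<close>, \<open>P = w'\<close> and \<open>Q\<close> satisfy
  \<open>E' = E P\<close>, \<open>P' = Q (\<epsilon> E - 1)\<close>, \<open>Q' = Q (1 - \<epsilon> E) P / N\<close>, a polynomial system, so uniform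
  convergence of the three functions bootstraps to convergence in every \<open>C\<^sup>n\<close>
  (\<open>vortex_system_Ck_limit\<close>). Both metrics are products of \<open>Q\<close> or \<open>E\<close> with fixed smooth functions
  on the punctured plane. Since \<open>cosh (ln r) = (1 + r\<^sup>2) / (2 r)\<close>, the limits are the round metric and
  the weight \<open>(2 / (1 + r\<^sup>2)) ^ (2 N)\<close>, both of which extend over the poles.
\<close>

section \<open>Smooth convergence through closure properties\<close>

text \<open>
  Continuity of the limit is included because it bounds the limit on compact sets, which makes
  the notion stable under products.
\<close>

definition locally_uniform_limit ::
    "complex set \<Rightarrow> (real \<Rightarrow> complex \<Rightarrow> real) \<Rightarrow> (complex \<Rightarrow> real) \<Rightarrow> real filter \<Rightarrow> bool" where
  "locally_uniform_limit S f l F \<longleftrightarrow>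
     continuous_on S l \<and> (\<forall>K. compact K \<longrightarrow> K \<subseteq> S \<longrightarrow> uniform_limit K f l F)"

text \<open>
  The recursion peels off the innermost derivative, the one applied first, rather than the
  outermost one as \<^const>\<open>iter_deriv\<close> does. The Leibniz and chain rules then reduce order
  \<open>n + 1\<close> for a function to order \<open>n\<close> for explicit expressions in its first derivative.
\<close>

primrec Ck_limit ::
    "nat \<Rightarrow> complex set \<Rightarrow> (real \<Rightarrow> complex \<Rightarrow> real) \<Rightarrow> (complex \<Rightarrow> real) \<Rightarrow> real filter \<Rightarrow> bool" where
  "Ck_limit 0 S f l F \<longleftrightarrow> locally_uniform_limit S f l F"
| "Ck_limit (Suc n) S f l F \<longleftrightarrow> locally_uniform_limit S f l F \<and>
     (\<forall>\<^sub>F b in F. \<forall>z\<in>S. f b differentiable (at z)) \<and>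
     (\<forall>z\<in>S. l differentiable (at z)) \<and>
     (\<forall>v. Ck_limit n S (\<lambda>b z. frechet_derivative (f b) (at z) v)
                       (\<lambda>z. frechet_derivative l (at z) v) F)"

lemma Ck_limit_imp_locally_uniform: "Ck_limit n S f l F \<Longrightarrow> locally_uniform_limit S f l F"
  by (cases n) auto

lemma Ck_limit_Suc_imp: "Ck_limit (Suc n) S f l F \<Longrightarrow> Ck_limit n S f l F"
proof (induction n arbitrary: f l)
  case (Suc n)
  then show ?case
    by (subst Ck_limit.simps(2), subst (asm) Ck_limit.simps(2)) blast
qed simp

lemma locally_uniform_limit_cong:
  assumes "locally_uniform_limit S f l F"
    and "\<forall>\<^sub>F b in F. \<forall>z\<in>S. f b z = g b z" and "\<And>z. z \<in> S \<Longrightarrow> l z = m z"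
  shows "locally_uniform_limit S g m F"
  unfolding locally_uniform_limit_def
proof (intro conjI allI impI)
  show "continuous_on S m"
    using assms by (metis continuous_on_cong locally_uniform_limit_def)
  fix K assume K: "compact K" "K \<subseteq> S"
  then have "uniform_limit K f l F"
    using assms(1) by (simp add: locally_uniform_limit_def)
  moreover have "\<forall>\<^sub>F b in F. \<forall>z\<in>K. f b z = g b z"
    using assms(2) by (rule eventually_mono) (use K in blast)
  moreover have "\<And>z. z \<in> K \<Longrightarrow> l z = m z" using assms(3) K by blast
  ultimately show "uniform_limit K g m F"
    using uniform_limit_cong by blast
qed

lemma Ck_limit_cong:
  assumes "open S" "Ck_limit n S f l F"
    and "\<forall>\<^sub>F b in F. \<forall>z\<in>S. f b z = g b z" and "\<And>z. z \<in> S \<Longrightarrow> l z = m z"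
  shows "Ck_limit n S g m F"
  using assms(2-)
proof (induction n arbitrary: f l g m)
  case 0
  then show ?case using locally_uniform_limit_cong by auto
next
  case (Suc n)
  have transf: "q differentiable (at z)"
      "frechet_derivative p (at z) = frechet_derivative q (at z)"
    if p: "p differentiable (at z)" and z: "z \<in> S" and eq: "\<And>z. z \<in> S \<Longrightarrow> p z = q z"
    for p q :: "complex \<Rightarrow> real" and z
  proof -
    have "(p has_derivative frechet_derivative p (at z)) (at z)"
      using p by (simp add: frechet_derivative_works)
    then have "(q has_derivative frechet_derivative p (at z)) (at z)"
      by (rule has_derivative_transform_within_open[OF _ \<open>open S\<close> z eq])
    then show "q differentiable (at z)"
      "frechet_derivative p (at z) = frechet_derivative q (at z)"
      by (rule differentiableI, rule frechet_derivative_at)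
  qed
  have diff: "\<forall>\<^sub>F b in F. \<forall>z\<in>S. f b differentiable (at z)" and
    diff_l: "\<And>z. z \<in> S \<Longrightarrow> l differentiable (at z)" and
    loc: "locally_uniform_limit S f l F"
    using Suc.prems(1) by simp_all
  have "Ck_limit n S (\<lambda>b z. frechet_derivative (g b) (at z) v)
      (\<lambda>z. frechet_derivative m (at z) v) F" for v
  proof (rule Suc.IH)
    show "Ck_limit n S (\<lambda>b z. frechet_derivative (f b) (at z) v)
        (\<lambda>z. frechet_derivative l (at z) v) F"
      using Suc.prems(1) by simp
    show "\<forall>\<^sub>F b in F. \<forall>z\<in>S. frechet_derivative (f b) (at z) v = frechet_derivative (g b) (at z) v"
      using diff Suc.prems(2)
    proof eventually_elim
      case (elim b)
      then show ?case using transf(2)[of "f b" _ "g b"] by simp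
    qed
    show "frechet_derivative l (at z) v = frechet_derivative m (at z) v" if "z \<in> S" for z
      using transf(2)[OF diff_l[OF that] that Suc.prems(3)] by simp
  qed
  moreover have "\<forall>\<^sub>F b in F. \<forall>z\<in>S. g b differentiable (at z)"
    using diff Suc.prems(2)
  proof eventually_elim
    case (elim b)
    then show ?case using transf(1)[of "f b" _ "g b"] by simp
  qed
  moreover have "\<forall>z\<in>S. m differentiable (at z)"
    using transf(1)[OF diff_l _ Suc.prems(3)] by simp
  moreover have "locally_uniform_limit S g m F"
    by (rule locally_uniform_limit_cong[OF loc Suc.prems(2,3)])
  ultimately show ?case by simp
qed

text \<open>
  The form in which derivatives are computed: a formula for the first derivative on \<open>S\<close> may be
  used in place of \<^const>\<open>frechet_derivative\<close>.
\<close>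

lemma Ck_limit_SucI:
  assumes "open S" "locally_uniform_limit S f l F"
    and f: "\<forall>\<^sub>F b in F. \<forall>z\<in>S. (f b has_derivative f' b z) (at z)"
    and l: "\<And>z. z \<in> S \<Longrightarrow> (l has_derivative l' z) (at z)"
    and "\<And>v. Ck_limit n S (\<lambda>b z. f' b z v) (\<lambda>z. l' z v) F"
  shows "Ck_limit (Suc n) S f l F"
proof -
  have "Ck_limit n S (\<lambda>b z. frechet_derivative (f b) (at z) v)
      (\<lambda>z. frechet_derivative l (at z) v) F" for v
  proof (rule Ck_limit_cong[OF assms(1) assms(5)[of v]])
    show "\<forall>\<^sub>F b in F. \<forall>z\<in>S. f' b z v = frechet_derivative (f b) (at z) v"
      using f by (rule eventually_mono) (auto intro: fun_cong[OF frechet_derivative_at])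
  qed (simp add: frechet_derivative_at[OF l, symmetric])
  moreover have "\<forall>\<^sub>F b in F. \<forall>z\<in>S. f b differentiable (at z)"
    using f by eventually_elim (auto simp: differentiable_def)
  moreover have "\<forall>z\<in>S. l differentiable (at z)"
    using l by (auto simp: differentiable_def)
  ultimately show ?thesis using assms(2) by simp
qed

lemma locally_uniform_limit_const:
  "(c \<longlongrightarrow> c') F \<Longrightarrow> locally_uniform_limit S (\<lambda>b z. c b) (\<lambda>z. c') F"
  by (simp add: locally_uniform_limit_def uniform_limit_iff tendsto_iff eventually_mono)

lemma locally_uniform_limit_constant_family:
  "continuous_on S l \<Longrightarrow> locally_uniform_limit S (\<lambda>b. l) l F"
  by (auto simp: locally_uniform_limit_def uniform_limit_iff)

lemma Ck_limit_const:
  assumes "open S" "(c \<longlongrightarrow> c') F"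
  shows "Ck_limit n S (\<lambda>b z. c b) (\<lambda>z. c') F"
  using assms(2)
proof (induction n arbitrary: c c')
  case 0
  then show ?case by (simp add: locally_uniform_limit_const)
next
  case (Suc n)
  show ?case
  proof (rule Ck_limit_SucI[where f' = "\<lambda>_ _ _. 0" and l' = "\<lambda>_ _. 0"])
    show "Ck_limit n S (\<lambda>b z. 0) (\<lambda>z. 0) F" by (rule Suc.IH) (rule tendsto_const)
    show "\<forall>\<^sub>F b in F. \<forall>z\<in>S. ((\<lambda>z. c b) has_derivative (\<lambda>_. 0)) (at z)" by simp
  qed (simp_all add: assms(1) Suc.prems locally_uniform_limit_const)
qed

lemma locally_uniform_limit_add:
  assumes "locally_uniform_limit S f l F" "locally_uniform_limit S g m F"
  shows "locally_uniform_limit S (\<lambda>b z. f b z + g b z) (\<lambda>z. l z + m z) F"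
  using assms by (auto simp: locally_uniform_limit_def intro: continuous_on_add uniform_limit_add)

lemma locally_uniform_limit_mult:
  assumes "locally_uniform_limit S f l F" "locally_uniform_limit S g m F"
  shows "locally_uniform_limit S (\<lambda>b z. f b z * g b z) (\<lambda>z. l z * m z) F"
  unfolding locally_uniform_limit_def
proof (intro conjI allI impI)
  show "continuous_on S (\<lambda>z. l z * m z)"
    using assms by (auto simp: locally_uniform_limit_def intro: continuous_on_mult)
  fix K assume K: "compact K" "K \<subseteq> S"
  have "bounded (l ` K)" "bounded (m ` K)"
    using assms K unfolding locally_uniform_limit_def
    by (meson compact_continuous_image compact_imp_bounded continuous_on_subset)+
  then show "uniform_limit K (\<lambda>b z. f b z * g b z) (\<lambda>z. l z * m z) F"
    using assms K by (intro uniform_lim_mult) (auto simp: locally_uniform_limit_def)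
qed

lemma Ck_limit_add:
  assumes "open S" "Ck_limit n S f l F" "Ck_limit n S g m F"
  shows "Ck_limit n S (\<lambda>b z. f b z + g b z) (\<lambda>z. l z + m z) F"
  using assms(2-)
proof (induction n arbitrary: f l g m)
  case 0
  then show ?case by (simp add: locally_uniform_limit_add)
next
  case (Suc n)
  let ?D = "\<lambda>f z. frechet_derivative f (at z)"
  show ?case
  proof (rule Ck_limit_SucI[OF \<open>open S\<close>, where f' = "\<lambda>b z v. ?D (f b) z v + ?D (g b) z v"
          and l' = "\<lambda>z v. ?D l z v + ?D m z v"])
    have "\<forall>\<^sub>F b in F. \<forall>z\<in>S. f b differentiable (at z)" "\<forall>\<^sub>F b in F. \<forall>z\<in>S. g b differentiable (at z)"
      using Suc.prems by auto
    then show "\<forall>\<^sub>F b in F. \<forall>z\<in>S.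
        ((\<lambda>z. f b z + g b z) has_derivative (\<lambda>v. ?D (f b) z v + ?D (g b) z v)) (at z)"
      by eventually_elim (auto intro!: has_derivative_add simp flip: frechet_derivative_works)
    show "((\<lambda>z. l z + m z) has_derivative (\<lambda>v. ?D l z v + ?D m z v)) (at z)"
      if "z \<in> S" for z
      using that Suc.prems by (auto intro!: has_derivative_add simp flip: frechet_derivative_works)
    show "locally_uniform_limit S (\<lambda>b z. f b z + g b z) (\<lambda>z. l z + m z) F"
      using Suc.prems by (simp add: locally_uniform_limit_add)
    show "Ck_limit n S (\<lambda>b z. ?D (f b) z v + ?D (g b) z v) (\<lambda>z. ?D l z v + ?D m z v) F" for v
      by (rule Suc.IH) (use Suc.prems in simp_all)
  qed
qed

lemma Ck_limit_mult:
  assumes "open S" "Ck_limit n S f l F" "Ck_limit n S g m F"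
  shows "Ck_limit n S (\<lambda>b z. f b z * g b z) (\<lambda>z. l z * m z) F"
  using assms(2-)
proof (induction n arbitrary: f l g m)
  case 0
  then show ?case by (simp add: locally_uniform_limit_mult)
next
  case (Suc n)
  let ?D = "\<lambda>f z. frechet_derivative f (at z)"
  show ?case
  proof (rule Ck_limit_SucI[OF \<open>open S\<close>, where f' = "\<lambda>b z v. f b z * ?D (g b) z v + ?D (f b) z v * g b z"
          and l' = "\<lambda>z v. l z * ?D m z v + ?D l z v * m z"])
    have "\<forall>\<^sub>F b in F. \<forall>z\<in>S. f b differentiable (at z)" "\<forall>\<^sub>F b in F. \<forall>z\<in>S. g b differentiable (at z)"
      using Suc.prems by auto
    then show "\<forall>\<^sub>F b in F. \<forall>z\<in>S.
        ((\<lambda>z. f b z * g b z) has_derivative (\<lambda>v. f b z * ?D (g b) z v + ?D (f b) z v * g b z)) (at z)"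
      by eventually_elim (auto intro!: has_derivative_mult simp flip: frechet_derivative_works)
    show "((\<lambda>z. l z * m z) has_derivative (\<lambda>v. l z * ?D m z v + ?D l z v * m z)) (at z)"
      if "z \<in> S" for z
      using that Suc.prems by (auto intro!: has_derivative_mult simp flip: frechet_derivative_works)
    fix v
    have "Ck_limit n S f l F" "Ck_limit n S g m F"
      using Suc.prems by (auto dest: Ck_limit_Suc_imp simp del: Ck_limit.simps)
    then show "Ck_limit n S (\<lambda>b z. f b z * ?D (g b) z v + ?D (f b) z v * g b z)
        (\<lambda>z. l z * ?D m z v + ?D l z v * m z) F"
      using Suc.prems by (intro Ck_limit_add \<open>open S\<close> Suc.IH) simp_all
    show "locally_uniform_limit S (\<lambda>b z. f b z * g b z) (\<lambda>z. l z * m z) F"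
      using Suc.prems by (simp add: locally_uniform_limit_mult)
  qed
qed

lemma Ck_limit_power:
  assumes "open S" "Ck_limit n S f l F"
  shows "Ck_limit n S (\<lambda>b z. f b z ^ k) (\<lambda>z. l z ^ k) F"
  by (induction k) (auto intro: Ck_limit_const Ck_limit_mult assms)

lemma iter_deriv_snoc:
  "iter_deriv (vs @ [v]) f = iter_deriv vs (\<lambda>z. frechet_derivative f (at z) v)"
  by (induction vs) simp_all

lemma Ck_limit_iter_deriv:
  "Ck_limit (length vs + n) S f l F \<Longrightarrow> Ck_limit n S (\<lambda>b. iter_deriv vs (f b)) (iter_deriv vs l) F"
proof (induction vs arbitrary: f l rule: rev_induct)
  case (snoc v vs)
  then show ?case by (simp add: iter_deriv_snoc)
qed simp

lemma smooth_limit_onI: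
  assumes "\<And>n. Ck_limit n S f l F" "compact K" "K \<subseteq> S"
  shows "smooth_limit_on K f l F"
  unfolding smooth_limit_on_def
proof
  fix vs
  have "Ck_limit 0 S (\<lambda>b. iter_deriv vs (f b)) (iter_deriv vs l) F"
    using Ck_limit_iter_deriv assms(1) by blast
  then show "uniform_limit K (\<lambda>b. iter_deriv vs (f b)) (iter_deriv vs l) F"
    using assms by (simp add: locally_uniform_limit_def)
qed

text \<open>
  Smoothness of one function is read off from convergence to it, usually of the constant
  family, so the closure rules above also serve to prove smoothness.
\<close>

lemma smooth_funI:
  assumes "\<And>n. Ck_limit n UNIV f l F"
  shows "smooth_fun l"
  unfolding smooth_fun_def
proof (intro allI)
  fix vs z
  have "Ck_limit (Suc 0) UNIV (\<lambda>b. iter_deriv vs (f b)) (iter_deriv vs l) F"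
    using Ck_limit_iter_deriv assms by blast
  then show "iter_deriv vs l differentiable (at z)" by simp
qed

section \<open>Radial functions on the punctured plane\<close>

lemma has_derivative_Re_power:
  assumes "z \<noteq> (0::complex)"
  shows "((\<lambda>z. Re (c / z ^ k)) has_derivative (\<lambda>v. Re (- (of_nat k * c * v) / z ^ Suc k))) (at z)"
proof -
  have "((\<lambda>z. c / z ^ k) has_field_derivative - (of_nat k * c) / z ^ Suc k) (at z)"
  proof (cases k)
    case (Suc m)
    show ?thesis
      unfolding Suc by (rule derivative_eq_intros refl)+
        (use assms in \<open>auto simp: field_simps\<close>)
  qed simp
  then have "((\<lambda>z. c / z ^ k) has_derivative (\<lambda>v. - (of_nat k * c * v) / z ^ Suc k)) (at z)"
    unfolding has_field_derivative_def by (rule has_derivative_eq_rhs) (auto simp: fun_eq_iff)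
  then show ?thesis by (rule has_derivative_Re)
qed

text \<open>
  The functions \<open>Re (c / z ^ k)\<close> are closed under directional derivatives, so the induction needs
  nothing else; \<^const>\<open>dt_form\<close> and \<^const>\<open>dtheta_form\<close> are the case \<open>k = 1\<close>.
\<close>

lemma Ck_limit_Re_power: "Ck_limit n (- {0}) (\<lambda>b z. Re (c / z ^ k)) (\<lambda>z. Re (c / z ^ k)) F"
proof (induction n arbitrary: c k)
  case 0
  have "locally_uniform_limit (- {0}) (\<lambda>b z. Re (c / z ^ k)) (\<lambda>z. Re (c / z ^ k)) F"
    by (intro locally_uniform_limit_constant_family continuous_intros) auto
  then show ?case by simp
next
  case (Suc n)
  show ?case
  proof (rule Ck_limit_SucI[where f' = "\<lambda>_ z v. Re (- (of_nat k * c * v) / z ^ Suc k)"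
        and l' = "\<lambda>z v. Re (- (of_nat k * c * v) / z ^ Suc k)"])
    show "locally_uniform_limit (- {0}) (\<lambda>b z. Re (c / z ^ k)) (\<lambda>z. Re (c / z ^ k)) F"
      by (intro locally_uniform_limit_constant_family continuous_intros) auto
    show "Ck_limit n (- {0}) (\<lambda>b z. Re (- (of_nat k * c * v) / z ^ Suc k))
        (\<lambda>z. Re (- (of_nat k * c * v) / z ^ Suc k)) F" for v
      by (rule Suc.IH)
    show "\<forall>\<^sub>F b in F. \<forall>z\<in>- {0}. ((\<lambda>z. Re (c / z ^ k)) has_derivative
        (\<lambda>v. Re (- (of_nat k * c * v) / z ^ Suc k))) (at z)"
      by (intro always_eventually allI ballI has_derivative_Re_power) simp
    show "((\<lambda>z. Re (c / z ^ k)) has_derivative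
        (\<lambda>v. Re (- (of_nat k * c * v) / z ^ Suc k))) (at z)" if "z \<in> - {0}" for z
      by (rule has_derivative_Re_power) (use that in simp)
  qed auto
qed

lemma Ck_limit_dt_form: "Ck_limit n (- {0}) (\<lambda>b z. dt_form z v) (\<lambda>z. dt_form z v) F"
  using Ck_limit_Re_power[of n v 1] by (simp add: dt_form_def)

lemma Ck_limit_dtheta_form: "Ck_limit n (- {0}) (\<lambda>b z. dtheta_form z v) (\<lambda>z. dtheta_form z v) F"
proof -
  have "Re (- \<i> * v / z ^ 1) = dtheta_form z v" for z
  proof -
    have "- \<i> * v / z ^ 1 = - (\<i> * (v / z))" by simp
    then show ?thesis
      by (simp only: dtheta_form_def uminus_complex.sel Re_i_times minus_minus)
  qed
  then show ?thesis using Ck_limit_Re_power[of n "- \<i> * v" 1] by simp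
qed

lemma has_derivative_ln_cmod:
  assumes "z \<noteq> 0" and f: "(f has_real_derivative f') (at (ln (cmod z)))"
  shows "((\<lambda>z. f (ln (cmod z))) has_derivative (\<lambda>v. f' * dt_form z v)) (at z)"
proof -
  have "(cmod has_derivative (\<lambda>v. v \<bullet> sgn z)) (at z)"
    using has_derivative_norm[OF assms(1)] by simp
  then have "((\<lambda>z. ln (cmod z)) has_derivative (\<lambda>v. inverse (cmod z) * (v \<bullet> sgn z))) (at z)"
    using assms(1) DERIV_ln[of "cmod z"]
    by (auto simp: has_field_derivative_def intro: has_derivative_compose[of cmod _ z UNIV ln])
  moreover have "inverse (cmod z) * (v \<bullet> sgn z) = dt_form z v" for v
    using assms(1) cmod_power2[of z]
    by (simp add: dt_form_def sgn_eq inner_complex_def Re_divide flip: cmod_power2)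
      (simp add: field_simps power2_eq_square)
  ultimately have "((\<lambda>z. ln (cmod z)) has_derivative dt_form z) (at z)" by simp
  from has_derivative_compose[OF this f[unfolded has_field_derivative_def]]
  show ?thesis by simp
qed

lemma locally_uniform_limit_ln_cmod:
  assumes f: "\<And>T. uniform_limit {- T..T} f l F" and l: "continuous_on UNIV l"
  shows "locally_uniform_limit (- {0}) (\<lambda>b z. f b (ln (cmod z))) (\<lambda>z. l (ln (cmod z))) F"
  unfolding locally_uniform_limit_def
proof (intro conjI allI impI)
  have c: "continuous_on (- {0}) (\<lambda>z. ln (cmod z))"
    by (intro continuous_intros) auto
  then show "continuous_on (- {0}) (\<lambda>z. l (ln (cmod z)))"
    by (rule continuous_on_compose2[OF l]) auto
  fix K :: "complex set" assume K: "compact K" "K \<subseteq> - {0}"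
  have "bounded ((\<lambda>z. ln (cmod z)) ` K)"
    by (intro compact_imp_bounded compact_continuous_image continuous_on_subset[OF c] K)
  then obtain T where "\<forall>z\<in>K. \<bar>ln (cmod z)\<bar> \<le> T"
    unfolding bounded_iff by auto
  then show "uniform_limit K (\<lambda>b z. f b (ln (cmod z))) (\<lambda>z. l (ln (cmod z))) F"
    by (intro uniform_limit_compose'[OF f[of T]]) (auto simp: abs_le_iff)
qed

text \<open>
  The right-hand sides are written with sums and products only, so that the closure rules for
  \<^const>\<open>Ck_limit\<close> apply to them literally.
\<close>

definition vortex_system ::
    "real \<Rightarrow> real \<Rightarrow> (real \<Rightarrow> real) \<Rightarrow> (real \<Rightarrow> real) \<Rightarrow> (real \<Rightarrow> real) \<Rightarrow> bool" where
  "vortex_system a \<epsilon> E P Q \<longleftrightarrow> (\<forall>t.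
     (E has_real_derivative E t * P t) (at t) \<and>
     (P has_real_derivative Q t * (\<epsilon> * E t + - 1)) (at t) \<and>
     (Q has_real_derivative Q t * (1 + - 1 * \<epsilon> * E t) * (a * P t)) (at t))"

text \<open>
  The bootstrap. The derivative of a radial function \<open>f (ln \<bar>z\<bar>)\<close> is \<open>f' (ln \<bar>z\<bar>)\<close> times
  \<^const>\<open>dt_form\<close>, and the system expresses \<open>f'\<close> polynomially in \<open>E\<close>, \<open>P\<close>, \<open>Q\<close>; convergence
  in \<open>C\<^sup>n\<close> of the three functions therefore yields convergence in \<open>C\<^sup>n\<^sup>+\<^sup>1\<close>. The three must be
  treated simultaneously.
\<close>

lemma vortex_system_Ck_limit:
  assumes sys: "\<forall>\<^sub>F b in F. vortex_system a (\<epsilon> b) (E b) (P b) (Q b)" "vortex_system a 0 E0 P0 Q0"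
    and \<epsilon>: "(\<epsilon> \<longlongrightarrow> 0) F"
    and lim: "\<And>T. uniform_limit {- T..T} E E0 F" "\<And>T. uniform_limit {- T..T} P P0 F"
      "\<And>T. uniform_limit {- T..T} Q Q0 F"
  shows "Ck_limit n (- {0}) (\<lambda>b z. E b (ln (cmod z))) (\<lambda>z. E0 (ln (cmod z))) F \<and>
    Ck_limit n (- {0}) (\<lambda>b z. P b (ln (cmod z))) (\<lambda>z. P0 (ln (cmod z))) F \<and>
    Ck_limit n (- {0}) (\<lambda>b z. Q b (ln (cmod z))) (\<lambda>z. Q0 (ln (cmod z))) F"
proof -
  have op: "open (- {0 :: complex})" by (rule open_Compl[OF closed_singleton])
  note sysD = vortex_system_def[THEN iffD1, rule_format]
  have base:
    "locally_uniform_limit (- {0}) (\<lambda>b z. E b (ln (cmod z))) (\<lambda>z. E0 (ln (cmod z))) F"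
    "locally_uniform_limit (- {0}) (\<lambda>b z. P b (ln (cmod z))) (\<lambda>z. P0 (ln (cmod z))) F"
    "locally_uniform_limit (- {0}) (\<lambda>b z. Q b (ln (cmod z))) (\<lambda>z. Q0 (ln (cmod z))) F"
    using sysD[OF sys(2)]
    by (intro locally_uniform_limit_ln_cmod lim DERIV_continuous_on[of UNIV]; auto)+
  show ?thesis
  proof (induction n)
    case 0
    then show ?case using base by simp
  next
    case (Suc n)
    note IH = Suc.IH[THEN conjunct1] Suc.IH[THEN conjunct2, THEN conjunct1]
      Suc.IH[THEN conjunct2, THEN conjunct2]
    note closure = Ck_limit_mult[OF op] Ck_limit_add[OF op] Ck_limit_const[OF op tendsto_const]
      Ck_limit_const[OF op \<epsilon>] Ck_limit_dt_form IH
    have step: "Ck_limit (Suc n) (- {0}) (\<lambda>b z. f b (ln (cmod z))) (\<lambda>z. l (ln (cmod z))) F"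
      if loc: "locally_uniform_limit (- {0}) (\<lambda>b z. f b (ln (cmod z))) (\<lambda>z. l (ln (cmod z))) F"
        and f: "\<forall>\<^sub>F b in F. \<forall>t. (f b has_real_derivative f' b t) (at t)"
        and l: "\<forall>t. (l has_real_derivative l' t) (at t)"
        and D: "Ck_limit n (- {0}) (\<lambda>b z. f' b (ln (cmod z))) (\<lambda>z. l' (ln (cmod z))) F"
      for f l f' l'
    proof (rule Ck_limit_SucI[OF op loc, where f' = "\<lambda>b z v. f' b (ln (cmod z)) * dt_form z v"
          and l' = "\<lambda>z v. l' (ln (cmod z)) * dt_form z v"])
      show "\<forall>\<^sub>F b in F. \<forall>z\<in>- {0}. ((\<lambda>z. f b (ln (cmod z))) has_derivative
          (\<lambda>v. f' b (ln (cmod z)) * dt_form z v)) (at z)"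
        using f by (rule eventually_mono) (auto intro: has_derivative_ln_cmod)
      show "((\<lambda>z. l (ln (cmod z))) has_derivative (\<lambda>v. l' (ln (cmod z)) * dt_form z v)) (at z)"
        if "z \<in> - {0}" for z
        using that l by (auto intro: has_derivative_ln_cmod)
      show "Ck_limit n (- {0}) (\<lambda>b z. f' b (ln (cmod z)) * dt_form z v)
          (\<lambda>z. l' (ln (cmod z)) * dt_form z v) F" for v
        by (rule Ck_limit_mult[OF op D Ck_limit_dt_form])
    qed
    have "Ck_limit (Suc n) (- {0}) (\<lambda>b z. E b (ln (cmod z))) (\<lambda>z. E0 (ln (cmod z))) F"
      by (rule step[OF base(1), where f' = "\<lambda>b t. E b t * P b t" and l' = "\<lambda>t. E0 t * P0 t"])
        (use sys in \<open>auto simp: vortex_system_def elim: eventually_mono intro: closure\<close>)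
    moreover have "Ck_limit (Suc n) (- {0}) (\<lambda>b z. P b (ln (cmod z))) (\<lambda>z. P0 (ln (cmod z))) F"
    proof (rule step[OF base(2)])
      show "\<forall>\<^sub>F b in F. \<forall>t. (P b has_real_derivative Q b t * (\<epsilon> b * E b t + - 1)) (at t)"
        using sys(1) by (rule eventually_mono) (simp add: vortex_system_def)
      show "\<forall>t. (P0 has_real_derivative Q0 t * (0 * E0 t + - 1)) (at t)"
        using sys(2) by (simp add: vortex_system_def)
    qed (intro closure)
    moreover have "Ck_limit (Suc n) (- {0}) (\<lambda>b z. Q b (ln (cmod z))) (\<lambda>z. Q0 (ln (cmod z))) F"
    proof (rule step[OF base(3)])
      show "\<forall>\<^sub>F b in F. \<forall>t. (Q b has_real_derivative
          Q b t * (1 + - 1 * \<epsilon> b * E b t) * (a * P b t)) (at t)"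
        using sys(1) by (rule eventually_mono) (simp add: vortex_system_def)
      show "\<forall>t. (Q0 has_real_derivative Q0 t * (1 + - 1 * 0 * E0 t) * (a * P0 t)) (at t)"
        using sys(2) by (simp add: vortex_system_def)
    qed (intro closure)
    ultimately show ?case by blast
  qed
qed

section \<open>The round metrics\<close>

definition herm_sq :: "vec2 \<Rightarrow> real" where
  "herm_sq Z = (cmod (fst Z))\<^sup>2 + (cmod (snd Z))\<^sup>2"

definition area_form :: "vec2 \<Rightarrow> vec2 \<Rightarrow> complex" where
  "area_form Z V = fst Z * snd V - snd Z * fst V"

text \<open>
  The pullback to \<open>\<complex>\<^sup>2\<close> of the round metric: \<^const>\<open>area_form\<close> vanishes on radial vectors and
  scales like \<open>c\<^sup>2\<close>, which makes the quotient basic.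
\<close>

definition fubini_study :: "real \<Rightarrow> tensor2" where
  "fubini_study a Z V W = a * Re (area_form Z V * cnj (area_form Z W)) / (herm_sq Z)\<^sup>2"

definition fubini_study_weight :: "nat \<Rightarrow> bundle_metric" where
  "fubini_study_weight k Z = (2 / herm_sq Z) ^ k"

abbreviation fs_density :: "complex \<Rightarrow> real" where
  "fs_density z \<equiv> inverse (1 + (cmod z)\<^sup>2)"

lemma one_plus_cmod_sq_pos: "1 + (cmod z)\<^sup>2 > 0"
  by (simp add: add_pos_nonneg)

lemma herm_sq_lift: "herm_sq (lift c z) = 1 + (cmod z)\<^sup>2"
  by (cases c) (simp_all add: herm_sq_def)

lemma herm_sq_cscale: "herm_sq (cscale c Z) = (cmod c)\<^sup>2 * herm_sq Z"
  by (simp add: herm_sq_def cscale_def norm_mult power_mult_distrib distrib_left)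

lemma herm_sq_pos: "Z \<noteq> 0 \<Longrightarrow> herm_sq Z > 0"
  by (cases Z) (auto simp: herm_sq_def zero_prod_def add_pos_nonneg add_nonneg_pos)

lemma local_tensor_fubini_study:
  "local_tensor (fubini_study a) c z v w = a * Re (v * cnj w) * (fs_density z)\<^sup>2"
  by (cases c)
    (simp_all add: local_tensor_def fubini_study_def herm_sq_lift area_form_def
      divide_inverse power_inverse del: lift.simps, simp_all)

lemma local_weight_fubini_study:
  "local_weight (fubini_study_weight k) c z = (2 * fs_density z) ^ k"
  by (simp add: local_weight_def fubini_study_weight_def herm_sq_lift divide_inverse)

lemma has_derivative_cmod_sq:
  "((\<lambda>z. 1 + (cmod z)\<^sup>2) has_derivative (\<lambda>v. 2 * Re (cnj v * z))) (at z)"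
proof -
  have "((\<lambda>z. 1 + ((Re z)\<^sup>2 + (Im z)\<^sup>2)) has_derivative
      (\<lambda>v. 0 + (2 * Re z * Re v + 2 * Im z * Im v))) (at z)"
    by (auto intro!: derivative_eq_intros)
  then show ?thesis by (simp add: cmod_power2 algebra_simps)
qed

lemma has_derivative_fs_density:
  "(fs_density has_derivative (\<lambda>v. - 1 * (fs_density z)\<^sup>2 * Re (2 * cnj v * z))) (at z)"
proof -
  have "1 + (cmod z)\<^sup>2 \<noteq> 0" using one_plus_cmod_sq_pos[of z] by simp
  from Deriv.has_derivative_inverse[OF this has_derivative_cmod_sq] show ?thesis
    by (simp add: power2_eq_square mult_ac power_inverse)
qed

lemma Ck_limit_Re_linear: "Ck_limit n UNIV (\<lambda>b z. Re (c * z)) (\<lambda>z. Re (c * z)) F"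
proof -
  have loc: "locally_uniform_limit UNIV (\<lambda>b z. Re (c * z)) (\<lambda>z. Re (c * z)) F"
    by (intro locally_uniform_limit_constant_family continuous_intros)
  show ?thesis
  proof (cases n)
    case (Suc m)
    have d: "((\<lambda>z. Re (c * z)) has_derivative (\<lambda>v. Re (c * v))) (at z)" for z
      by (auto intro!: derivative_eq_intros)
    show ?thesis
      unfolding Suc
      by (rule Ck_limit_SucI[OF open_UNIV loc, where f' = "\<lambda>_ _ v. Re (c * v)"
            and l' = "\<lambda>_ v. Re (c * v)"])
        (simp_all only: d Ck_limit_const[OF open_UNIV tendsto_const] eventually_True ball_UNIV simp_thms)
  qed (use loc in simp)
qed

text \<open>
  The density \<open>\<rho> = 1 / (1 + \<bar>z\<bar>\<^sup>2)\<close> satisfies \<open>D\<^sub>v \<rho> = - \<rho>\<^sup>2 Re (2 cnj v z)\<close>, which is again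
  polynomial in \<open>\<rho>\<close> and linear functions.
\<close>

lemma Ck_limit_fs_density: "Ck_limit n UNIV (\<lambda>b. fs_density) fs_density F"
proof (induction n)
  case 0
  have "locally_uniform_limit UNIV (\<lambda>b. fs_density) fs_density F"
    using has_derivative_fs_density
    by (intro locally_uniform_limit_constant_family has_derivative_continuous_on)
      (blast intro: has_derivative_at_withinI)
  then show ?case by simp
next
  case (Suc n)
  show ?case
  proof (rule Ck_limit_SucI[OF open_UNIV,
        where f' = "\<lambda>_ z v. - 1 * (fs_density z)\<^sup>2 * Re (2 * cnj v * z)"
        and l' = "\<lambda>z v. - 1 * (fs_density z)\<^sup>2 * Re (2 * cnj v * z)"])
    show "locally_uniform_limit UNIV (\<lambda>b. fs_density) fs_density F"
      by (rule Ck_limit_imp_locally_uniform[OF Suc.IH])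
    show "\<forall>\<^sub>F b in F. \<forall>z\<in>UNIV. (fs_density has_derivative
        (\<lambda>v. - 1 * (fs_density z)\<^sup>2 * Re (2 * cnj v * z))) (at z)"
      by (intro always_eventually allI ballI has_derivative_fs_density)
    show "Ck_limit n UNIV (\<lambda>b z. - 1 * (fs_density z)\<^sup>2 * Re (2 * cnj v * z))
        (\<lambda>z. - 1 * (fs_density z)\<^sup>2 * Re (2 * cnj v * z)) F" for v
      by (intro Ck_limit_mult Ck_limit_power Ck_limit_const Ck_limit_Re_linear open_UNIV
          tendsto_const Suc.IH)
  qed (rule has_derivative_fs_density)
qed

lemma riemannian_metric_fubini_study:
  assumes "a > 0"
  shows "riemannian_metric (fubini_study a)"
  unfolding riemannian_metric_def
proof (intro conjI allI impI)
  show "basic_tensor (fubini_study a)"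
    unfolding basic_tensor_def
  proof (intro allI impI)
    fix Z V W :: vec2 and c x y :: complex
    assume "Z \<noteq> 0" "c \<noteq> 0"
    have area: "area_form (cscale c Z) (cscale c V + cscale x Z) = c\<^sup>2 * area_form Z V" for V x
      by (simp add: area_form_def cscale_def algebra_simps power2_eq_square)
    have "Re (c\<^sup>2 * area_form Z V * cnj (c\<^sup>2 * area_form Z W)) =
        Re (of_real ((cmod c)\<^sup>2 ^ 2) * (area_form Z V * cnj (area_form Z W)))"
    proof -
      have "complex_of_real ((cmod c)\<^sup>2 ^ 2) = (c * cnj c)\<^sup>2"
        by (metis complex_norm_square of_real_power)
      then show ?thesis
        by (simp only: power_mult_distrib complex_cnj_mult complex_cnj_power mult_ac)
    qed
    also have "\<dots> = ((cmod c)\<^sup>2)\<^sup>2 * Re (area_form Z V * cnj (area_form Z W))"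
      by (simp only: times_complex.sel Re_complex_of_real Im_complex_of_real mult_zero_left diff_zero)
    finally show "fubini_study a (cscale c Z) (cscale c V + cscale x Z) (cscale c W + cscale y Z) =
        fubini_study a Z V W"
      using \<open>c \<noteq> 0\<close>
      by (simp add: fubini_study_def area herm_sq_cscale power_mult_distrib)
  qed
  fix c z v w
  show "bilinear (local_tensor (fubini_study a) c z)"
    unfolding bilinear_def local_tensor_fubini_study
    by (auto intro!: linearI simp: algebra_simps)
  show "local_tensor (fubini_study a) c z v w = local_tensor (fubini_study a) c z w v"
    by (simp add: local_tensor_fubini_study algebra_simps)
  show "local_tensor (fubini_study a) c z v v > 0" if "v \<noteq> 0"
  proof -
    have "Re (v * cnj v) > 0"
      using that by (simp add: complex_norm_square[symmetric])
    then show ?thesis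
      using assms one_plus_cmod_sq_pos[of z] by (simp add: local_tensor_fubini_study)
  qed
  show "smooth_fun (\<lambda>z. local_tensor (fubini_study a) c z v w)"
    unfolding local_tensor_fubini_study
    by (rule smooth_funI[where f = "\<lambda>_ z. a * Re (v * cnj w) * (fs_density z)\<^sup>2" and F = at_top])
      (intro Ck_limit_mult Ck_limit_power Ck_limit_const Ck_limit_fs_density open_UNIV
          tendsto_const)
qed

lemma kaehler_form_fubini_study:
  "of_real (kaehler_form (fubini_study (2 * a)) c z v w) = of_real a * omega0 z v w"
proof -
  have eq: "of_real (2 * Re (\<i> * v * cnj w)) = \<i> * dz_dzbar v w"
    by (simp add: dz_dzbar_def complex_eq_iff)
  then have "of_real (2 * a * Re (\<i> * v * cnj w) * (fs_density z)\<^sup>2) =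
      of_real a * (\<i> * dz_dzbar v w) * of_real ((fs_density z)\<^sup>2)"
  proof -
    have "2 * a * Re (\<i> * v * cnj w) * (fs_density z)\<^sup>2 =
        a * (2 * Re (\<i> * v * cnj w)) * (fs_density z)\<^sup>2" by simp
    then show ?thesis by (simp only: of_real_mult[of _ "(fs_density z)\<^sup>2"] of_real_mult[of a] eq)
  qed
  then show ?thesis
    unfolding kaehler_form_def local_tensor_fubini_study omega0_def
    by (auto simp: divide_inverse power_inverse)
qed

lemma hermitian_metric_fubini_study_weight: "hermitian_metric k (fubini_study_weight k)"
  unfolding hermitian_metric_def
proof (intro conjI allI impI)
  fix Z :: vec2 and c :: complex
  assume Z: "Z \<noteq> 0"
  then show "fubini_study_weight k Z > 0"
    by (simp add: fubini_study_weight_def herm_sq_pos)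
  assume "c \<noteq> 0"
  then show "fubini_study_weight k (cscale c Z) * cmod c ^ (2 * k) = fubini_study_weight k Z"
    using herm_sq_pos[OF Z]
    by (simp add: fubini_study_weight_def herm_sq_cscale power_mult power_mult_distrib[symmetric])
next
  fix c
  show "smooth_fun (local_weight (fubini_study_weight k) c)"
    unfolding local_weight_fubini_study[abs_def]
    by (rule smooth_funI[where f = "\<lambda>_ z. (2 * fs_density z) ^ k" and F = at_top])
      (intro Ck_limit_mult Ck_limit_power Ck_limit_const Ck_limit_fs_density open_UNIV
          tendsto_const)
qed

text \<open>
  With \<open>\<rho> = 1 / (1 + \<bar>z\<bar>\<^sup>2)\<close>, the \<open>z\<close>-bar derivative of \<open>ln (1 + \<bar>z\<bar>\<^sup>2)\<close> is \<open>z \<rho>\<close>, and the \<open>z\<close>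
  derivative of that is \<open>\<rho> - \<rho>\<^sup>2 \<bar>z\<bar>\<^sup>2 = \<rho>\<^sup>2\<close>, the density of \<^const>\<open>omega0\<close>.
\<close>

lemma curvature_form_fubini_study:
  "\<i> * curvature_form (fubini_study_weight k) c z v w = of_nat k * omega0 z v w"
proof -
  let ?h = "local_weight (fubini_study_weight k) c"
  have ln: "ln (?h z) = real k * ln 2 - real k * ln (1 + (cmod z)\<^sup>2)" for z
    unfolding local_weight_fubini_study using one_plus_cmod_sq_pos[of z]
    by (simp add: ln_realpow ln_mult ln_inverse algebra_simps)
  have "((\<lambda>z. complex_of_real (ln (?h z))) has_derivative
      (\<lambda>v. of_real (- (real k * (fs_density z * (2 * Re (cnj v * z))))))) (at z)" for z
    unfolding ln
    by (rule derivative_eq_intros has_derivative_cmod_sq one_plus_cmod_sq_pos refl)+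
      (simp add: divide_inverse mult_ac)
  note D = frechet_derivative_at[OF this, symmetric]
  have "d_zbar (\<lambda>z. of_real (ln (?h z))) = (\<lambda>z. - of_nat k * (z * of_real (fs_density z)))"
  proof
    fix z
    define r where "r = fs_density z"
    show "d_zbar (\<lambda>z. of_real (ln (?h z))) z = - of_nat k * (z * of_real (fs_density z))"
      unfolding d_zbar_def D r_def[symmetric] by (simp add: complex_eq_iff algebra_simps)
  qed
  moreover have "d_z (\<lambda>z. - of_nat k * (z * of_real (fs_density z))) z =
      - of_nat k * (of_real (fs_density z) - of_real ((fs_density z)\<^sup>2) * (z * cnj z))"
  proof -
    define r where "r = fs_density z"
    have "((\<lambda>z. - of_nat k * (z * of_real (fs_density z))) has_derivative
        (\<lambda>v. - of_nat k * (z * of_real (- 1 * r\<^sup>2 * Re (2 * cnj v * z)) + v * of_real r))) (at z)"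
      unfolding r_def
      by (rule derivative_eq_intros has_derivative_fs_density has_derivative_of_real refl)+
    from frechet_derivative_at[OF this, symmetric] show ?thesis
      unfolding d_z_def r_def[symmetric]
      by (simp only:) (simp add: complex_eq_iff field_simps power2_eq_square)
  qed
  moreover have "of_real (fs_density z) - of_real ((fs_density z)\<^sup>2) * (z * cnj z) =
      complex_of_real ((fs_density z)\<^sup>2)"
  proof -
    have "fs_density z - (fs_density z)\<^sup>2 * (cmod z)\<^sup>2 = (fs_density z)\<^sup>2"
    proof -
      have "fs_density z * (1 + (cmod z)\<^sup>2) = 1" using one_plus_cmod_sq_pos[of z] by simp
      then show ?thesis by algebra
    qed
    then have "complex_of_real (fs_density z - (fs_density z)\<^sup>2 * (cmod z)\<^sup>2) =
        of_real ((fs_density z)\<^sup>2)" by (rule arg_cong)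
    then show ?thesis by (simp only: of_real_diff of_real_mult complex_norm_square)
  qed
  ultimately have "d_z (d_zbar (\<lambda>z. of_real (ln (?h z)))) z = - of_nat k * of_real ((fs_density z)\<^sup>2)"
    by (simp only:)
  then have "curvature_form (fubini_study_weight k) c z v w =
      of_nat k * of_real ((fs_density z)\<^sup>2) * dz_dzbar v w"
    by (simp only: curvature_form_def mult_minus_left minus_minus)
  then show ?thesis
    by (simp add: omega0_def divide_inverse power_inverse)
qed

section \<open>Compact sets off the poles\<close>

lemma rep_cp1_nonzero: "rep_cp1 p \<noteq> 0"
  using Quotient3_rep_reflp[OF Quotient3_cp1] by (auto simp: proj_rel_def)

lemma proj_rep_cp1: "proj (rep_cp1 p) = p"
  by (rule Quotient3_abs_rep[OF Quotient3_cp1])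

lemma proj_eq_iff:
  assumes "Z \<noteq> 0" "W \<noteq> 0"
  shows "proj Z = proj W \<longleftrightarrow> (\<exists>c. c \<noteq> 0 \<and> W = cscale c Z)"
proof -
  have refl: "proj_rel Z Z" if "Z \<noteq> 0" for Z
    unfolding proj_rel_def using that by (auto intro!: exI[of _ 1] simp: cscale_def)
  have "proj Z = proj W \<longleftrightarrow> proj_rel Z W"
    using Quotient3_rel[OF Quotient3_cp1, of Z W] refl assms by blast
  with assms show ?thesis by (simp add: proj_rel_def)
qed

text \<open>
  The regions \<open>\<bar>z\<^sub>0\<bar> < n \<bar>z\<^sub>1\<bar>, \<bar>z\<^sub>1\<bar> < n \<bar>z\<^sub>0\<bar>\<close> form an increasing open cover of the complement of
  the poles, so a compact set lies in one of them; in the coordinate \<open>z\<close> these are annuli.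
\<close>

lemma compact_off_poles_subset:
  assumes K: "compact K" "K \<subseteq> - {pt_zero, pt_infinity}"
  obtains A where "compact A" "A \<subseteq> - {0}" "{z. proj (lift U0 z) \<in> K} \<subseteq> A"
proof -
  define P where "P n Z \<longleftrightarrow>
    cmod (fst Z) < real n * cmod (snd Z) \<and> cmod (snd Z) < real n * cmod (fst Z)" for n and Z :: vec2
  define V where "V n = {p. P n (rep_cp1 p)}" for n
  have P_cscale: "P n (cscale c Z) \<longleftrightarrow> P n Z" if "c \<noteq> 0" for n c Z
    using that by (simp add: P_def cscale_def norm_mult mult.left_commute[of "real n"])
  have V_iff: "proj Z \<in> V n \<longleftrightarrow> P n Z" if nz: "Z \<noteq> 0" for Z n
  proof -
    obtain c where "c \<noteq> 0" "rep_cp1 (proj Z) = cscale c Z"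
      using proj_eq_iff[OF nz rep_cp1_nonzero] proj_rep_cp1 by metis
    then show ?thesis by (simp add: V_def P_cscale)
  qed
  have "open (V n)" for n
  proof -
    have "{Z. Z \<noteq> 0 \<and> proj Z \<in> V n} = {Z. P n Z}"
    proof -
      have "P n Z \<Longrightarrow> Z \<noteq> 0" for Z by (auto simp: P_def)
      then show ?thesis using V_iff by blast
    qed
    moreover have "open {Z. P n Z}"
      unfolding P_def by (intro open_Collect_conj open_Collect_less continuous_intros)
    ultimately show ?thesis by (simp add: open_cp1_def)
  qed
  moreover have "K \<subseteq> (\<Union>n\<in>UNIV. V n)"
  proof
    fix p assume "p \<in> K"
    obtain x y where Z: "rep_cp1 p = (x, y)" by fastforce
    then have nz: "(x, y) \<noteq> 0" and p: "p = proj (x, y)"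
      using rep_cp1_nonzero[of p] proj_rep_cp1[of p] by auto
    have "x \<noteq> 0"
    proof
      assume "x = 0"
      then have "proj (lift U1 0) = proj (x, y)"
        using nz by (subst proj_eq_iff) (auto simp: cscale_def zero_prod_def)
      then show False using p K(2) \<open>p \<in> K\<close> by auto
    qed
    moreover have "y \<noteq> 0"
    proof
      assume "y = 0"
      then have "proj (lift U0 0) = proj (x, y)"
        using nz by (subst proj_eq_iff) (auto simp: cscale_def zero_prod_def)
      then show False using p K(2) \<open>p \<in> K\<close> by auto
    qed
    moreover obtain n where "max (cmod x / cmod y) (cmod y / cmod x) < real n"
      using reals_Archimedean2 by blast
    ultimately have "P n (x, y)" by (simp add: P_def divide_less_eq)
    then show "p \<in> (\<Union>n\<in>UNIV. V n)" using Z by (auto simp: V_def)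
  qed
  ultimately obtain C where C: "finite C" "K \<subseteq> (\<Union>n\<in>C. V n)"
    using compactE_image[OF K(1), of UNIV V] by metis
  define m where "m = Max (insert 1 C)"
  let ?A = "{z. 1 / real m \<le> cmod z \<and> cmod z \<le> real m}"
  have m: "m \<ge> 1" "\<And>n. n \<in> C \<Longrightarrow> n \<le> m"
    using C(1) by (auto simp: m_def)
  show thesis
  proof
    have "closed ?A"
      by (intro closed_Collect_conj closed_Collect_le continuous_intros)
    moreover have "bounded ?A"
      by (rule bounded_subset[OF bounded_cball[of 0 "real m"]]) auto
    ultimately show "compact ?A" by (simp add: compact_eq_bounded_closed)
    show "?A \<subseteq> - {0}" using m(1) by auto
    show "{z. proj (lift U0 z) \<in> K} \<subseteq> ?A"
    proof
      fix z assume "z \<in> {z. proj (lift U0 z) \<in> K}"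
      then obtain n where n: "n \<in> C" "proj (1, z) \<in> V n" using C(2) by auto
      then have "P n (1, z)" using V_iff[of "(1, z)"] by (simp add: zero_prod_def)
      then have "1 < real n * cmod z" "cmod z < real n" by (auto simp: P_def)
      moreover have "real n \<le> real m" using m n by simp
      moreover from this have "real n * cmod z \<le> real m * cmod z"
        by (intro mult_right_mono) auto
      ultimately have "1 \<le> real m * cmod z" "cmod z \<le> real m" by linarith+
      then show "z \<in> ?A" using m(1) by (simp add: divide_le_eq mult.commute)
    qed
  qed
qed

section \<open>Stability of second-order equations\<close>

text \<open>
  Gronwall's inequality: \<open>exp (- M t) (\<phi> + \<kappa> / M)\<close> is nonincreasing.
\<close>

lemma gronwall_affine:
  fixes \<phi> :: "real \<Rightarrow> real"
  assumes d: "\<And>t. (\<phi> has_real_derivative \<phi>' t) (at t)"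
    and le: "\<And>t. \<phi>' t \<le> M * \<phi> t + \<kappa>" and "M > 0" "\<phi> 0 = 0" "t \<ge> 0"
  shows "\<phi> t \<le> \<kappa> / M * (exp (M * t) - 1)"
proof -
  let ?\<psi> = "\<lambda>t. exp (- M * t) * (\<phi> t + \<kappa> / M)"
  have "?\<psi> t \<le> ?\<psi> 0"
  proof (rule DERIV_nonpos_imp_nonincreasing[OF \<open>t \<ge> 0\<close>])
    fix x
    have "(?\<psi> has_real_derivative exp (- M * x) * (\<phi>' x - (M * \<phi> x + \<kappa>))) (at x)"
      by (rule derivative_eq_intros d refl)+ (use \<open>M > 0\<close> in \<open>simp add: field_simps\<close>)
    moreover have "exp (- M * x) * (\<phi>' x - (M * \<phi> x + \<kappa>)) \<le> 0"
      using le[of x] by (simp add: mult_le_0_iff)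
    ultimately show "\<exists>y. (?\<psi> has_real_derivative y) (at x) \<and> y \<le> 0" by blast
  qed
  then have "exp (M * t) * ?\<psi> t \<le> exp (M * t) * (\<kappa> / M)"
    using \<open>\<phi> 0 = 0\<close> by (intro mult_left_mono) auto
  moreover have "exp (M * t) * ?\<psi> t = \<phi> t + \<kappa> / M"
    by (simp add: exp_minus field_simps)
  ultimately show ?thesis by (simp add: algebra_simps)
qed

text \<open>
  Gronwall's inequality for \<open>(x - y)\<^sup>2 + (p - q)\<^sup>2\<close>, where the cross terms are absorbed by
  \<open>2 r s \<le> r\<^sup>2 + s\<^sup>2\<close>.
\<close>

lemma second_order_stability_pos:
  fixes x y p q a c :: "real \<Rightarrow> real"
  assumes x: "\<And>t. (x has_real_derivative p t) (at t)" "\<And>t. (p has_real_derivative a t) (at t)"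
    and y: "\<And>t. (y has_real_derivative q t) (at t)" "\<And>t. (q has_real_derivative c t) (at t)"
    and init: "x 0 = y 0" "p 0 = q 0"
    and le: "\<And>t. \<bar>a t - c t\<bar> \<le> L * \<bar>x t - y t\<bar> + \<delta>" and "L \<ge> 0" "\<delta> \<ge> 0" "t \<ge> 0"
  shows "\<bar>x t - y t\<bar> \<le> \<delta> * exp ((L + 2) * t) \<and> \<bar>p t - q t\<bar> \<le> \<delta> * exp ((L + 2) * t)"
proof -
  let ?d = "\<lambda>t. x t - y t" and ?e = "\<lambda>t. p t - q t"
  let ?M = "L + 2"
  have "(?d t)\<^sup>2 + (?e t)\<^sup>2 \<le> \<delta>\<^sup>2 / ?M * (exp (?M * t) - 1)"
  proof (rule gronwall_affine[where \<phi> = "\<lambda>t. (?d t)\<^sup>2 + (?e t)\<^sup>2"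
        and \<phi>' = "\<lambda>t. 2 * ?d t * ?e t + 2 * ?e t * (a t - c t)"])
    show "((\<lambda>t. (?d t)\<^sup>2 + (?e t)\<^sup>2) has_real_derivative
        2 * ?d t * ?e t + 2 * ?e t * (a t - c t)) (at t)" for t
      by (rule derivative_eq_intros x y refl)+ (simp add: power2_eq_square algebra_simps)
    show "2 * ?d t * ?e t + 2 * ?e t * (a t - c t) \<le> ?M * ((?d t)\<^sup>2 + (?e t)\<^sup>2) + \<delta>\<^sup>2" for t
    proof -
      have sq: "2 * (r * s) \<le> r\<^sup>2 + s\<^sup>2" for r s :: real
        using sum_squares_bound[of r s] by simp
      have "?e t * (a t - c t) \<le> \<bar>?e t\<bar> * (L * \<bar>?d t\<bar> + \<delta>)"
      proof -
        have "?e t * (a t - c t) \<le> \<bar>?e t\<bar> * \<bar>a t - c t\<bar>"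
          unfolding abs_mult[symmetric] by (rule abs_ge_self)
        also have "\<dots> \<le> \<bar>?e t\<bar> * (L * \<bar>?d t\<bar> + \<delta>)"
          by (rule mult_left_mono[OF le]) simp
        finally show ?thesis .
      qed
      moreover have "?d t * ?e t \<le> \<bar>?d t\<bar> * \<bar>?e t\<bar>"
        unfolding abs_mult[symmetric] by (rule abs_ge_self)
      ultimately have "2 * ?d t * ?e t + 2 * ?e t * (a t - c t)
          \<le> (L + 1) * (2 * (\<bar>?d t\<bar> * \<bar>?e t\<bar>)) + 2 * (\<bar>?e t\<bar> * \<delta>)"
        by (simp add: algebra_simps)
      also have "\<dots> \<le> (L + 1) * ((?d t)\<^sup>2 + (?e t)\<^sup>2) + ((?e t)\<^sup>2 + \<delta>\<^sup>2)"
        using sq[of "\<bar>?d t\<bar>" "\<bar>?e t\<bar>"] sq[of "\<bar>?e t\<bar>" \<delta>] \<open>L \<ge> 0\<close>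
        by (intro add_mono mult_left_mono) simp_all
      also have "\<dots> \<le> ?M * ((?d t)\<^sup>2 + (?e t)\<^sup>2) + \<delta>\<^sup>2"
        by (simp add: algebra_simps)
      finally show ?thesis .
    qed
  qed (use assms in auto)
  also have "\<dots> \<le> \<delta>\<^sup>2 * exp (?M * t)"
  proof -
    have "\<delta>\<^sup>2 / ?M \<le> \<delta>\<^sup>2" using \<open>L \<ge> 0\<close> by (simp add: divide_le_eq mult_le_cancel_left1)
    then show ?thesis using \<open>L \<ge> 0\<close> \<open>t \<ge> 0\<close> by (intro mult_mono) auto
  qed
  also have "\<dots> \<le> \<delta>\<^sup>2 * (exp (?M * t))\<^sup>2"
    using \<open>L \<ge> 0\<close> \<open>t \<ge> 0\<close> by (intro mult_left_mono self_le_power) auto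
  finally have le: "(?d t)\<^sup>2 + (?e t)\<^sup>2 \<le> (\<delta> * exp (?M * t))\<^sup>2"
    by (simp add: power_mult_distrib)
  have "\<delta> * exp (?M * t) \<ge> 0" using \<open>\<delta> \<ge> 0\<close> by simp
  moreover have "(?d t)\<^sup>2 \<le> (\<delta> * exp (?M * t))\<^sup>2" "(?e t)\<^sup>2 \<le> (\<delta> * exp (?M * t))\<^sup>2"
    by (rule order_trans[OF _ le], simp)+
  ultimately show ?thesis by (simp add: abs_le_square_iff[symmetric])
qed

text \<open>
  Negative times follow by reflecting \<open>t\<close>, which preserves a second-order equation without
  first-order term and changes the sign of the velocity.
\<close>

lemma second_order_stability:
  fixes x y p q a c :: "real \<Rightarrow> real"
  assumes x: "\<And>t. (x has_real_derivative p t) (at t)" "\<And>t. (p has_real_derivative a t) (at t)"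
    and y: "\<And>t. (y has_real_derivative q t) (at t)" "\<And>t. (q has_real_derivative c t) (at t)"
    and init: "x 0 = y 0" "p 0 = q 0"
    and le: "\<And>t. \<bar>a t - c t\<bar> \<le> L * \<bar>x t - y t\<bar> + \<delta>" and "L \<ge> 0" "\<delta> \<ge> 0"
  shows "\<bar>x t - y t\<bar> \<le> \<delta> * exp ((L + 2) * \<bar>t\<bar>) \<and> \<bar>p t - q t\<bar> \<le> \<delta> * exp ((L + 2) * \<bar>t\<bar>)"
proof (cases "t \<ge> 0")
  case True
  then show ?thesis using second_order_stability_pos[OF assms, of t] by simp
next
  case False
  have reflect: "((\<lambda>t. f (- t)) has_real_derivative - f' (- t)) (at t)"
    if "\<And>t. (f has_real_derivative f' t) (at t)" for f f' :: "real \<Rightarrow> real" and t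
    using DERIV_mirror[of f "f' (- t)" t] that[of "- t"] by simp
  have reflect': "((\<lambda>t. - f (- t)) has_real_derivative f' (- t)) (at t)"
    if "\<And>t. (f has_real_derivative f' t) (at t)" for f f' :: "real \<Rightarrow> real" and t
    using DERIV_minus[OF reflect[OF that, of t]] by simp
  have "\<bar>x (- (- t)) - y (- (- t))\<bar> \<le> \<delta> * exp ((L + 2) * - t) \<and>
      \<bar>- p (- (- t)) - - q (- (- t))\<bar> \<le> \<delta> * exp ((L + 2) * - t)"
  proof (rule second_order_stability_pos)
    show "((\<lambda>t. x (- t)) has_real_derivative - p (- t)) (at t)" for t by (rule reflect[OF x(1)])
    show "((\<lambda>t. - p (- t)) has_real_derivative a (- t)) (at t)" for t by (rule reflect'[OF x(2)])
    show "((\<lambda>t. y (- t)) has_real_derivative - q (- t)) (at t)" for t by (rule reflect[OF y(1)])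
    show "((\<lambda>t. - q (- t)) has_real_derivative c (- t)) (at t)" for t by (rule reflect'[OF y(2)])
    show "\<bar>a (- t) - c (- t)\<bar> \<le> L * \<bar>x (- t) - y (- t)\<bar> + \<delta>" for t by (rule le)
  qed (use init \<open>L \<ge> 0\<close> \<open>\<delta> \<ge> 0\<close> False in auto)
  moreover have "\<bar>t\<bar> = - t" using False by simp
  ultimately show ?thesis by (simp add: abs_minus_commute)
qed

lemma exp_lipschitz_atMost:
  fixes x y :: real
  assumes "x \<le> c" "y \<le> c"
  shows "\<bar>exp x - exp y\<bar> \<le> exp c * \<bar>x - y\<bar>"
proof -
  have "exp r - exp s \<le> exp c * (r - s)" if "s \<le> r" "r \<le> c" for r s :: real
  proof -
    have "exp r - exp s = exp r * (1 - exp (s - r))" by (simp add: exp_diff field_simps)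
    also have "\<dots> \<le> exp c * (r - s)"
    proof (rule mult_mono)
      show "1 - exp (s - r) \<le> r - s" using exp_ge_add_one_self[of "s - r"] by linarith
    qed (use that in auto)
    finally show ?thesis .
  qed
  from this[of x y] this[of y x] show ?thesis using assms by (cases "x \<le> y") auto
qed

section \<open>The energy and the maximum of Yang's solutions\<close>

lemma yang_solutionD:
  assumes "yang_solution N b u"
  shows "(u has_real_derivative deriv u t) (at t)"
    and "(deriv u has_real_derivative conf_factor N b (u t) * (exp (u t) - 1)) (at t)"
    and "u 0 = - b" and "deriv u 0 = 0"
proof -
  obtain u' where u': "\<And>t. (u has_real_derivative u' t) (at t)"
      "\<And>t. (u' has_real_derivative conf_factor N b (u t) * (exp (u t) - 1)) (at t)"
      "u 0 = - b" "u' 0 = 0"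
    using assms unfolding yang_solution_def by blast
  have "deriv u = u'" using DERIV_imp_deriv[OF u'(1)] by blast
  with u' show "(u has_real_derivative deriv u t) (at t)"
    "(deriv u has_real_derivative conf_factor N b (u t) * (exp (u t) - 1)) (at t)"
    "u 0 = - b" "deriv u 0 = 0" by auto
qed

text \<open>
  The conformal factor in terms of \<open>w = x + b\<close>; the large exponential in \<^const>\<open>yang_lambda\<close>
  cancels and only \<open>\<epsilon> = exp (- b)\<close> remains.
\<close>

lemma conf_factor_eq:
  "conf_factor N b x =
    2 * real N * exp ((x + b + exp (- b) * (1 - exp (x + b))) / real N)"
proof -
  have e: "exp (- b) * exp (x + b) = exp x" by (simp flip: exp_add)
  have "conf_factor N b x = 2 * real N * (exp ((b + exp (- b)) / real N) * exp ((x - exp x) / real N))"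
    by (simp add: conf_factor_def yang_lambda_def coupling_def)
  also have "exp ((b + exp (- b)) / real N) * exp ((x - exp x) / real N) =
      exp ((x + b + (exp (- b) - exp (- b) * exp (x + b))) / real N)"
    unfolding e exp_add[symmetric] add_divide_distrib[symmetric]
    by (intro arg_cong[where f = exp] arg_cong2[where f = "(/)"]) simp_all
  finally show ?thesis by (simp add: right_diff_distrib)
qed

lemma DERIV_conf_factor:
  assumes "N \<ge> 1" and u: "(u has_real_derivative p) (at t)"
  shows "((\<lambda>t. conf_factor N b (u t)) has_real_derivative
    conf_factor N b (u t) * (1 - exp (u t)) * p / real N) (at t)"
  unfolding conf_factor_def
  by (rule derivative_eq_intros u refl)+ (use \<open>N \<ge> 1\<close> in \<open>simp add: coupling_def field_simps\<close>)

text \<open>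
  The function \<open>u'\<^sup>2 / 2 + N Q\<close> is conserved, so \<open>Q\<close> never exceeds its initial value, which says
  \<open>u - exp u \<le> - b - exp (- b)\<close>. The value \<open>u = 0\<close> violates this inequality, hence \<open>u\<close> stays
  negative by continuity; on the negative axis \<open>x - exp x\<close> is increasing, which gives \<open>u \<le> - b\<close>.
\<close>

lemma yang_solution_le:
  assumes "N \<ge> 1" "b > 0" and u: "yang_solution N b u"
  shows "u t \<le> - b"
proof -
  note sol = yang_solutionD[OF u]
  let ?C = "\<lambda>t. conf_factor N b (u t)"
  let ?W = "\<lambda>t. (deriv u t)\<^sup>2 / 2 + real N * ?C t"
  have W: "(?W has_real_derivative 0) (at t)" for t
  proof -
    have "((\<lambda>t. (deriv u t)\<^sup>2 / 2) has_real_derivative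
        deriv u t * (?C t * (exp (u t) - 1))) (at t)"
      using DERIV_cdivide[OF DERIV_mult[OF sol(2) sol(2)], of 2 t]
      by (simp add: power2_eq_square mult.commute)
    then have "(?W has_real_derivative deriv u t * (?C t * (exp (u t) - 1)) +
        real N * (?C t * (1 - exp (u t)) * deriv u t / real N)) (at t)"
      by (rule DERIV_add[OF _ DERIV_cmult[OF DERIV_conf_factor[OF \<open>N \<ge> 1\<close> sol(1)]]])
    then show ?thesis
      by (rule DERIV_cong) (use \<open>N \<ge> 1\<close> in \<open>simp add: field_simps\<close>)
  qed
  have energy: "u t - exp (u t) \<le> - b - exp (- b)" for t
  proof -
    have "?W t = ?W 0" using DERIV_isconst_all W by blast
    then have "(deriv u t)\<^sup>2 / 2 + real N * ?C t = real N * ?C 0"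
      using sol(4) by simp
    then have "real N * ?C t \<le> real N * ?C 0"
      using zero_le_power2[of "deriv u t"] by linarith
    then have "?C t \<le> ?C 0" using \<open>N \<ge> 1\<close> by simp
    then have "(u t + b + exp (- b) * (1 - exp (u t + b))) / real N \<le>
        (u 0 + b + exp (- b) * (1 - exp (u 0 + b))) / real N"
      using \<open>N \<ge> 1\<close> unfolding conf_factor_eq by simp
    then have "u t + b + exp (- b) * (1 - exp (u t + b)) \<le> 0"
      using \<open>N \<ge> 1\<close> sol(3) by (simp add: divide_le_0_iff)
    moreover have "exp (- b) * exp (u t + b) = exp (u t)" by (simp add: exp_add[symmetric])
    ultimately show ?thesis by (simp add: algebra_simps)
  qed
  have nz: "u s \<noteq> 0" for s
  proof
    \<comment> \<open>At \<open>u = 0\<close> the energy bound says \<open>exp (- b) \<le> 1 - b\<close>, the equality case of \<open>1 + x \<le> exp x\<close>.\<close>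
    assume "u s = 0"
    with energy[of s] have "exp (- b) \<le> 1 - b" by simp
    with exp_ge_add_one_self[of "- b"] have "ln (exp (- b)) = exp (- b) - 1" by simp
    then have "exp (- b) = 1" by (intro ln_eq_minus_one) auto
    with \<open>b > 0\<close> show False by simp
  qed
  have "connected (range u)"
    using sol(1) by (intro connected_continuous_image connected_UNIV)
      (meson DERIV_isCont continuous_at_imp_continuous_on)
  then have neg: "u t < 0"
    using nz sol(3) \<open>b > 0\<close> connectedD_interval[of "range u" "- b" "u t" 0]
    by (metis linorder_not_less neg_le_0_iff_le order_less_imp_le rangeE rangeI)
  show ?thesis
  proof (rule ccontr)
    assume "\<not> u t \<le> - b"
    then have "\<bar>exp (u t) - exp (- b)\<bar> \<le> exp (u t) * (u t + b)" "u t + b > 0"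
      using exp_lipschitz_atMost[of "u t" "u t" "- b"] by auto
    moreover have "u t + b \<le> \<bar>exp (u t) - exp (- b)\<bar>" using energy[of t] by linarith
    moreover have "exp (u t) * (u t + b) < u t + b"
      using neg \<open>u t + b > 0\<close> by simp
    ultimately show False by (meson leD order_trans)
  qed
qed

text \<open>
  By homogeneity of the Hermitian metric, the state function equals \<open>exp u\<close> off the poles,
  whatever representative \<^const>\<open>rep_cp1\<close> selects; at the poles the Higgs field vanishes.
\<close>

lemma norm_sq_yang_hermitian:
  assumes "N \<ge> 1" and H: "yang_hermitian N u H"
  obtains (zero) "norm_sq H (higgs N) p = 0"
    | (orbit) "norm_sq H (higgs N) p = exp (u (ln (cmod (snd (rep_cp1 p) / fst (rep_cp1 p)))))"
proof -
  obtain x y where Z: "rep_cp1 p = (x, y)" by fastforce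
  show thesis
  proof (cases "x = 0 \<or> y = 0")
    case True
    then have "norm_sq H (higgs N) p = 0"
      using \<open>N \<ge> 1\<close> by (auto simp: norm_sq_def higgs_def Z)
    then show thesis by (rule zero)
  next
    case False
    then have xy: "x \<noteq> 0" "y \<noteq> 0" by auto
    let ?z = "y / x"
    have "H (cscale x (1, ?z)) * cmod x ^ (2 * (2 * N)) = H (1, ?z)"
      using H xy by (auto simp: yang_hermitian_def hermitian_metric_def zero_prod_def)
    moreover have "cscale x (1, ?z) = (x, y)" using xy by (simp add: cscale_def)
    ultimately have "H (x, y) * cmod x ^ (2 * (2 * N)) = local_weight H U0 ?z"
      by (simp add: local_weight_def)
    also have "\<dots> = exp (u (ln (cmod ?z))) / cmod ?z ^ (2 * N)"
      using H xy by (simp add: yang_hermitian_def)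
    finally have eq: "H (x, y) * cmod x ^ (2 * (2 * N)) =
        exp (u (ln (cmod ?z))) / cmod ?z ^ (2 * N)" .
    define X Y where "X = cmod x ^ (2 * N)" and "Y = cmod y ^ (2 * N)"
    have "X \<noteq> 0" "Y \<noteq> 0" using xy by (auto simp: X_def Y_def)
    moreover have "cmod x ^ (2 * (2 * N)) = X * X" "cmod ?z ^ (2 * N) = Y / X"
      by (simp_all add: X_def Y_def norm_divide power_divide flip: power_add mult_2)
    moreover define e where "e = exp (u (ln (cmod ?z)))"
    ultimately have "H (x, y) * (X * X) = e / (Y / X)"
      using eq by (simp only:)
    with \<open>X \<noteq> 0\<close> \<open>Y \<noteq> 0\<close> have "H (x, y) * (X * Y) = exp (u (ln (cmod ?z)))"
      unfolding e_def[symmetric] by (simp add: field_simps)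
    then have "H (x, y) * (cmod x ^ (2 * N) * cmod y ^ (2 * N)) = exp (u (ln (cmod ?z)))"
      by (simp add: X_def Y_def)
    then have "norm_sq H (higgs N) p = exp (u (ln (cmod ?z)))"
      by (simp add: norm_sq_def higgs_def Z norm_mult norm_power power_mult_distrib mult_ac
          flip: power_mult)
    then show thesis using orbit Z by simp
  qed
qed

lemma norm_sq_yang_le:
  assumes "N \<ge> 1" "b > 0" "yang_solution N b u" "yang_hermitian N u H"
  shows "norm_sq H (higgs N) p \<in> {0..exp (- b)}"
  using yang_solution_le[OF assms(1-3)]
  by (cases rule: norm_sq_yang_hermitian[OF assms(1,4), of p]) auto

lemma SUP_norm_sq_yang:
  assumes "N \<ge> 1" "b > 0" "yang_solution N b u" "yang_hermitian N u H"
  shows "(SUP p. norm_sq H (higgs N) p) = exp (- b)"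
proof (rule cSup_eq_maximum)
  let ?p = "proj (1, 1)"
  have "(1, 1) \<noteq> (0 :: vec2)" by (simp add: zero_prod_def)
  then obtain c where c: "c \<noteq> 0" "rep_cp1 ?p = cscale c (1, 1)"
    using proj_eq_iff[OF _ rep_cp1_nonzero, of "(1, 1)" ?p] proj_rep_cp1 by metis
  have H: "H (cscale c (1, 1)) * cmod c ^ (2 * (2 * N)) = H (1, 1)" "local_weight H U0 1 = exp (u 0)"
    using assms(4) c by (auto simp: yang_hermitian_def hermitian_metric_def zero_prod_def)
  have "norm_sq H (higgs N) ?p = H (cscale c (1, 1)) * cmod c ^ (2 * (2 * N))"
    by (simp add: norm_sq_def higgs_def c cscale_def norm_mult norm_power mult_ac
        flip: power_add power_mult mult_2)
  also have "\<dots> = exp (- b)"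
    using H yang_solutionD(3)[OF assms(3)] by (simp add: local_weight_def)
  finally show "exp (- b) \<in> range (norm_sq H (higgs N))" by (metis rangeI)
next
  fix x assume "x \<in> range (norm_sq H (higgs N))"
  then show "x \<le> exp (- b)" using norm_sq_yang_le[OF assms] by auto
qed

section \<open>Convergence of the shifted solutions\<close>

lemma uniform_limit_exp_minus:
  fixes f :: "real \<Rightarrow> 'a \<Rightarrow> real"
  assumes "\<forall>\<^sub>F b in at_top. \<forall>x\<in>S. \<bar>f b x - l x\<bar> \<le> C * exp (- b)"
  shows "uniform_limit S f l at_top"
proof (rule uniform_limitI)
  fix e :: real assume "e > 0"
  have "((\<lambda>b. C * exp (- b)) \<longlongrightarrow> C * 0) at_top"
    by (intro tendsto_mult tendsto_const filterlim_compose[OF exp_at_bot] filterlim_uminus_at_bot_at_top)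
  then have "\<forall>\<^sub>F b in at_top. C * exp (- b) < e"
    using \<open>e > 0\<close> by (simp add: order_tendstoD(2))
  with assms show "\<forall>\<^sub>F b in at_top. \<forall>x\<in>S. dist (f b x) (l x) < e"
    by eventually_elim (auto simp: dist_real_def)
qed

text \<open>
  The solution \<open>w\<close> of \<open>w'' = - 2 N exp (w / N)\<close> with \<open>w(0) = w'(0) = 0\<close>.
\<close>

definition limit_profile :: "nat \<Rightarrow> real \<Rightarrow> real" where
  "limit_profile N t = - 2 * real N * ln (cosh t)"

lemma limit_profile_nonpos: "limit_profile N t \<le> 0"
  using cosh_real_ge_1[of t] by (simp add: limit_profile_def)

lemma exp_limit_profile: "exp (limit_profile N t) = 1 / (cosh t) ^ (2 * N)"
proof -
  have "exp (limit_profile N t) = exp (- (real (2 * N) * ln (cosh t)))"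
    by (simp add: limit_profile_def)
  also have "\<dots> = 1 / (cosh t) ^ (2 * N)"
    using cosh_real_pos[of t] by (simp only: exp_minus exp_of_nat_mult exp_ln inverse_eq_divide)
  finally show ?thesis .
qed

lemma exp_limit_profile_div: "N \<ge> 1 \<Longrightarrow> exp (limit_profile N t / real N) = 1 / (cosh t)\<^sup>2"
  using exp_limit_profile[of 1 t] by (simp add: limit_profile_def)

lemma DERIV_limit_profile:
  "(limit_profile N has_real_derivative - 2 * real N * tanh t) (at t)"
proof -
  have "((\<lambda>t. - 2 * real N * ln (cosh t)) has_real_derivative - 2 * real N * tanh t) (at t)"
    by (rule derivative_eq_intros refl cosh_real_pos)+ (simp add: tanh_def divide_inverse mult_ac)
  then show ?thesis by (simp add: limit_profile_def[abs_def])
qed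

lemma DERIV_limit_profile':
  assumes "N \<ge> 1"
  shows "((\<lambda>t. - 2 * real N * tanh t) has_real_derivative
    - (2 * real N * exp (limit_profile N t / real N))) (at t)"
proof -
  have "1 - (tanh t)\<^sup>2 = 1 / (cosh t)\<^sup>2"
  proof -
    have "1 - (tanh t)\<^sup>2 = ((cosh t)\<^sup>2 - (sinh t)\<^sup>2) / (cosh t)\<^sup>2"
      using cosh_real_pos[of t] by (simp add: tanh_def power_divide diff_divide_distrib)
    then show ?thesis using cosh_square_eq[of t] by simp
  qed
  moreover have "((\<lambda>t. - 2 * real N * tanh t) has_real_derivative
      - 2 * real N * (1 - (tanh t)\<^sup>2)) (at t)"
    using cosh_real_pos[of t] by (auto intro!: derivative_eq_intros)
  ultimately show ?thesis by (simp add: exp_limit_profile_div[OF assms])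
qed

text \<open>
  Compared with the limit, the conformal factor carries the extra factor
  \<open>exp (\<epsilon> (1 - exp w) / N)\<close> with \<open>\<epsilon> = exp (- b)\<close> and \<open>w = x + b \<le> 0\<close>. It lies between \<open>1\<close> and
  \<open>1 + 2 \<epsilon>\<close>, and the remaining factor \<open>1 - exp x\<close> lies between \<open>1 - \<epsilon>\<close> and \<open>1\<close>.
\<close>

lemma conf_factor_near_limit:
  assumes "N \<ge> 1" "exp (- b) \<le> 1 / 2" "x \<le> - b"
  shows "\<bar>conf_factor N b x - 2 * real N * exp ((x + b) / real N)\<bar> \<le> 4 * real N * exp (- b)"
    and "\<bar>conf_factor N b x * (exp x - 1) + 2 * real N * exp ((x + b) / real N)\<bar>
      \<le> 4 * real N * exp (- b)"
proof -
  let ?\<epsilon> = "exp (- b)" and ?w = "x + b"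
  let ?A = "2 * real N * exp (?w / real N)" and ?S = "exp (?\<epsilon> * (1 - exp ?w) / real N)"
  have S1: "1 \<le> ?S" using assms by simp
  have "?\<epsilon> * (1 - exp ?w) / real N \<le> ?\<epsilon>"
  proof -
    have "?\<epsilon> * (1 - exp ?w) \<le> ?\<epsilon> * 1" by (intro mult_left_mono) auto
    also have "\<dots> \<le> ?\<epsilon> * real N" using \<open>N \<ge> 1\<close> by simp
    finally show ?thesis using \<open>N \<ge> 1\<close> by (simp add: divide_le_eq)
  qed
  then have "?S \<le> exp ?\<epsilon>" by simp
  also have "\<dots> \<le> 1 + 2 * ?\<epsilon>" using assms by (intro real_exp_bound_lemma) auto
  finally have S2: "?S \<le> 1 + 2 * ?\<epsilon>" .
  have C: "conf_factor N b x = ?A * ?S"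
    by (simp add: conf_factor_eq add_divide_distrib exp_add)
  have A: "0 \<le> ?A" "?A \<le> 2 * real N"
  proof -
    have "exp (?w / real N) \<le> 1" using assms by (simp add: divide_le_0_iff)
    then show "?A \<le> 2 * real N" using mult_left_mono[of "exp (?w / real N)" 1 "2 * real N"] by simp
  qed simp
  have bound: "\<bar>?A * s\<bar> \<le> 4 * real N * ?\<epsilon>" if "\<bar>s\<bar> \<le> 2 * ?\<epsilon>" for s
  proof -
    have "\<bar>?A * s\<bar> = ?A * \<bar>s\<bar>" by (simp add: abs_mult)
    also have "\<dots> \<le> 2 * real N * (2 * ?\<epsilon>)" by (rule mult_mono[OF A(2) that]) auto
    finally show ?thesis by simp
  qed
  have "conf_factor N b x - ?A = ?A * (?S - 1)" by (simp add: C algebra_simps)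
  moreover have "\<bar>?S - 1\<bar> \<le> 2 * ?\<epsilon>" using S1 S2 by simp
  ultimately show "\<bar>conf_factor N b x - ?A\<bar> \<le> 4 * real N * ?\<epsilon>" using bound by metis
  have x: "0 \<le> exp x" "exp x \<le> ?\<epsilon>" using assms by auto
  have "\<bar>1 - s * r\<bar> \<le> 2 * e"
    if "s * r \<le> s" "r \<le> s * r" "s \<le> 1 + 2 * e" "1 - e \<le> r" "0 \<le> e" for s r e :: real
    unfolding abs_le_iff using that by (intro conjI; linarith)
  moreover have "?S * (1 - exp x) \<le> ?S" by (simp add: mult_le_cancel_left2)
  moreover have "1 * (1 - exp x) \<le> ?S * (1 - exp x)"
    by (rule mult_right_mono[OF S1]) (use x assms(2) in linarith)
  ultimately have "\<bar>1 - ?S * (1 - exp x)\<bar> \<le> 2 * ?\<epsilon>"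
    using S2 x by simp
  moreover have "conf_factor N b x * (exp x - 1) + ?A = ?A * (1 - ?S * (1 - exp x))"
    by (simp add: C algebra_simps)
  ultimately show "\<bar>conf_factor N b x * (exp x - 1) + ?A\<bar> \<le> 4 * real N * ?\<epsilon>"
    using bound by metis
qed

lemma limit_conf_lipschitz:
  assumes "N \<ge> 1" "x \<le> 0" "y \<le> 0"
  shows "\<bar>2 * real N * exp (x / real N) - 2 * real N * exp (y / real N)\<bar> \<le> 2 * \<bar>x - y\<bar>"
proof -
  have "\<bar>exp (x / real N) - exp (y / real N)\<bar> \<le> exp 0 * \<bar>x / real N - y / real N\<bar>"
    using assms by (intro exp_lipschitz_atMost) (auto simp: divide_le_0_iff)
  also have "\<dots> = \<bar>x - y\<bar> / real N"
    using assms by (simp add: diff_divide_distrib[symmetric])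
  finally have "2 * real N * \<bar>exp (x / real N) - exp (y / real N)\<bar> \<le> 2 * \<bar>x - y\<bar>"
    using assms by (simp add: field_simps)
  then show ?thesis
    by (simp add: right_diff_distrib[symmetric] abs_mult)
qed

text \<open>
  Stability with Lipschitz constant \<open>2\<close>, that of \<open>2 N exp (x / N)\<close> on the negative axis, and the
  perturbation \<open>4 N exp (- b)\<close>.
\<close>

lemma yang_solution_near_limit:
  assumes "N \<ge> 1" "b > 0" "exp (- b) \<le> 1 / 2" "yang_solution N b u"
  shows "\<bar>(u t + b) - limit_profile N t\<bar> \<le> 4 * real N * exp (- b) * exp (4 * \<bar>t\<bar>) \<and>
    \<bar>deriv u t - - 2 * real N * tanh t\<bar> \<le> 4 * real N * exp (- b) * exp (4 * \<bar>t\<bar>)"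
proof -
  note sol = yang_solutionD[OF assms(4)]
  note le = yang_solution_le[OF assms(1,2,4)]
  let ?c = "\<lambda>t. - (2 * real N * exp (limit_profile N t / real N))"
  have "\<bar>(u t + b) - limit_profile N t\<bar> \<le> 4 * real N * exp (- b) * exp ((2 + 2) * \<bar>t\<bar>) \<and>
    \<bar>deriv u t - - 2 * real N * tanh t\<bar> \<le> 4 * real N * exp (- b) * exp ((2 + 2) * \<bar>t\<bar>)"
  proof (rule second_order_stability)
    show "((\<lambda>t. u t + b) has_real_derivative deriv u t) (at t)" for t
      using DERIV_add[OF sol(1) DERIV_const[of b]] by simp
    show "\<bar>conf_factor N b (u t) * (exp (u t) - 1) - ?c t\<bar>
        \<le> 2 * \<bar>u t + b - limit_profile N t\<bar> + 4 * real N * exp (- b)" for t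
      using conf_factor_near_limit(2)[OF assms(1,3) le[of t]]
        limit_conf_lipschitz[OF assms(1), of "u t + b" "limit_profile N t"] le[of t]
        limit_profile_nonpos[of N t] by linarith
    show "(limit_profile N has_real_derivative - 2 * real N * tanh t) (at t)" for t
      by (rule DERIV_limit_profile)
    show "((\<lambda>t. - 2 * real N * tanh t) has_real_derivative ?c t) (at t)" for t
      by (rule DERIV_limit_profile'[OF assms(1)])
  qed (rule sol(2), simp_all add: sol(3,4) limit_profile_def)
  then show ?thesis by simp
qed

lemma yang_family_limits:
  assumes "N \<ge> 1" and sol: "\<And>b. b > 0 \<Longrightarrow> yang_solution N b (u b)"
  shows "uniform_limit {- T..T} (\<lambda>b t. exp (u b t + b)) (\<lambda>t. exp (limit_profile N t)) at_top"
    and "uniform_limit {- T..T} (\<lambda>b. deriv (u b)) (\<lambda>t. - 2 * real N * tanh t) at_top"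
    and "uniform_limit {- T..T} (\<lambda>b t. conf_factor N b (u b t))
      (\<lambda>t. 2 * real N * exp (limit_profile N t / real N)) at_top"
proof -
  define M where "M = 4 * real N * exp (4 * T)"
  have "((\<lambda>b :: real. exp (- b)) \<longlongrightarrow> 0) at_top"
    by (intro filterlim_compose[OF exp_at_bot] filterlim_uminus_at_bot_at_top)
  then have "\<forall>\<^sub>F b :: real in at_top. exp (- b) < 1 / 2"
    by (rule order_tendstoD(2)) simp
  then have large: "\<forall>\<^sub>F b :: real in at_top. b > 0 \<and> exp (- b) \<le> 1 / 2"
    using eventually_gt_at_top[of 0] by eventually_elim simp
  have close: "\<bar>(u b t + b) - limit_profile N t\<bar> \<le> M * exp (- b)"
      "\<bar>deriv (u b) t - - 2 * real N * tanh t\<bar> \<le> M * exp (- b)"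
    if "b > 0 \<and> exp (- b) \<le> 1 / 2" "t \<in> {- T..T}" for b t
  proof -
    have "4 * \<bar>t\<bar> \<le> 4 * T" using that by auto
    then have "4 * real N * exp (- b) * exp (4 * \<bar>t\<bar>) \<le> 4 * real N * exp (- b) * exp (4 * T)"
      by (intro mult_left_mono) auto
    then have "4 * real N * exp (- b) * exp (4 * \<bar>t\<bar>) \<le> M * exp (- b)"
      by (simp add: M_def mult_ac)
    note M = order_trans[OF _ this]
    have "b > 0" "exp (- b) \<le> 1 / 2" using that by auto
    note near = yang_solution_near_limit[OF assms(1) this sol[OF this(1)], of t]
    show "\<bar>(u b t + b) - limit_profile N t\<bar> \<le> M * exp (- b)"
      "\<bar>deriv (u b) t - - 2 * real N * tanh t\<bar> \<le> M * exp (- b)"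
      using near by (auto intro: M)
  qed
  have le: "u b t \<le> - b" if "b > 0" for b t
    using yang_solution_le[OF assms(1) that sol] that by blast
  have "\<forall>\<^sub>F b in at_top. \<forall>t\<in>{- T..T}.
      \<bar>exp (u b t + b) - exp (limit_profile N t)\<bar> \<le> M * exp (- b)"
    using large
  proof eventually_elim
    case (elim b)
    show ?case
    proof
      fix t assume "t \<in> {- T..T}"
      have "\<bar>exp (u b t + b) - exp (limit_profile N t)\<bar> \<le> exp 0 * \<bar>u b t + b - limit_profile N t\<bar>"
        using le[of b t] elim limit_profile_nonpos by (intro exp_lipschitz_atMost) auto
      also have "\<dots> \<le> M * exp (- b)" using close(1)[OF elim \<open>t \<in> _\<close>] by simp
      finally show "\<bar>exp (u b t + b) - exp (limit_profile N t)\<bar> \<le> M * exp (- b)" .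
    qed
  qed
  then show "uniform_limit {- T..T} (\<lambda>b t. exp (u b t + b)) (\<lambda>t. exp (limit_profile N t)) at_top"
    by (rule uniform_limit_exp_minus)
  show "uniform_limit {- T..T} (\<lambda>b. deriv (u b)) (\<lambda>t. - 2 * real N * tanh t) at_top"
    by (rule uniform_limit_exp_minus, rule eventually_mono[OF large]) (use close(2) in blast)
  have "\<forall>\<^sub>F b in at_top. \<forall>t\<in>{- T..T}.
      \<bar>conf_factor N b (u b t) - 2 * real N * exp (limit_profile N t / real N)\<bar>
        \<le> (4 * real N + 2 * M) * exp (- b)"
    using large
  proof eventually_elim
    case (elim b)
    show ?case
    proof
      fix t assume "t \<in> {- T..T}"
      have "b > 0" "exp (- b) \<le> 1 / 2" using elim by auto
      note le = le[OF \<open>b > 0\<close>, of t]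
      have "\<bar>conf_factor N b (u b t) - 2 * real N * exp ((u b t + b) / real N)\<bar>
          \<le> 4 * real N * exp (- b)"
        using assms(1) \<open>exp (- b) \<le> 1 / 2\<close> le by (rule conf_factor_near_limit(1))
      moreover have "\<bar>2 * real N * exp ((u b t + b) / real N)
            - 2 * real N * exp (limit_profile N t / real N)\<bar>
          \<le> 2 * \<bar>(u b t + b) - limit_profile N t\<bar>"
        using assms(1) le limit_profile_nonpos by (intro limit_conf_lipschitz) auto
      moreover note close(1)[OF elim \<open>t \<in> _\<close>]
      moreover have "\<bar>p - r\<bar> \<le> c + 2 * m"
        if "\<bar>p - q\<bar> \<le> c" "\<bar>q - r\<bar> \<le> 2 * d" "d \<le> m" for p q r c d m :: real
        using that by linarith
      ultimately have "\<bar>conf_factor N b (u b t) - 2 * real N * exp (limit_profile N t / real N)\<bar>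
          \<le> 4 * real N * exp (- b) + 2 * (M * exp (- b))"
        by blast
      then show "\<bar>conf_factor N b (u b t) - 2 * real N * exp (limit_profile N t / real N)\<bar>
          \<le> (4 * real N + 2 * M) * exp (- b)"
        by (simp add: distrib_right)
    qed
  qed
  then show "uniform_limit {- T..T} (\<lambda>b t. conf_factor N b (u b t))
      (\<lambda>t. 2 * real N * exp (limit_profile N t / real N)) at_top"
    by (rule uniform_limit_exp_minus)
qed

lemma yang_family_Ck_limits:
  assumes "N \<ge> 1" and sol: "\<And>b. b > 0 \<Longrightarrow> yang_solution N b (u b)"
  shows "Ck_limit n (- {0}) (\<lambda>b z. exp (u b (ln (cmod z)) + b))
      (\<lambda>z. exp (limit_profile N (ln (cmod z)))) at_top"
    and "Ck_limit n (- {0}) (\<lambda>b z. conf_factor N b (u b (ln (cmod z))))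
      (\<lambda>z. 2 * real N * exp (limit_profile N (ln (cmod z)) / real N)) at_top"
proof -
  have sys: "\<forall>\<^sub>F b in at_top. vortex_system (1 / real N) (exp (- b))
      (\<lambda>t. exp (u b t + b)) (deriv (u b)) (\<lambda>t. conf_factor N b (u b t))"
    using eventually_gt_at_top[of 0]
  proof eventually_elim
    case (elim b)
    note D = yang_solutionD[OF sol[OF elim]]
    have e: "exp (- b) * exp (u b t + b) = exp (u b t)" for t
      by (simp flip: exp_add)
    show ?case
      unfolding vortex_system_def
    proof (intro allI conjI)
      fix t
      have "((\<lambda>t. u b t + b) has_real_derivative deriv (u b) t) (at t)"
        using DERIV_add[OF D(1) DERIV_const[of b]] by simp
      then show "((\<lambda>t. exp (u b t + b)) has_real_derivative exp (u b t + b) * deriv (u b) t) (at t)"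
        by (rule DERIV_fun_exp)
      show "(deriv (u b) has_real_derivative
          conf_factor N b (u b t) * (exp (- b) * exp (u b t + b) + - 1)) (at t)"
        unfolding e using D(2)[of t] by simp
      show "((\<lambda>t. conf_factor N b (u b t)) has_real_derivative conf_factor N b (u b t) *
          (1 + - 1 * exp (- b) * exp (u b t + b)) * (1 / real N * deriv (u b) t)) (at t)"
        using DERIV_conf_factor[OF assms(1) D(1)[of t], of b]
        by (simp add: e mult.assoc[of "- 1"])
    qed
  qed
  have sys0: "vortex_system (1 / real N) 0 (\<lambda>t. exp (limit_profile N t))
      (\<lambda>t. - 2 * real N * tanh t) (\<lambda>t. 2 * real N * exp (limit_profile N t / real N))"
    unfolding vortex_system_def
  proof (intro allI conjI)
    fix t
    show "((\<lambda>t. exp (limit_profile N t)) has_real_derivative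
        exp (limit_profile N t) * (- 2 * real N * tanh t)) (at t)"
      by (rule DERIV_fun_exp[OF DERIV_limit_profile])
    show "((\<lambda>t. - 2 * real N * tanh t) has_real_derivative
        2 * real N * exp (limit_profile N t / real N) * (0 * exp (limit_profile N t) + - 1)) (at t)"
      using DERIV_limit_profile'[OF assms(1), of t] by simp
    show "((\<lambda>t. 2 * real N * exp (limit_profile N t / real N)) has_real_derivative
        2 * real N * exp (limit_profile N t / real N) *
          (1 + - 1 * 0 * exp (limit_profile N t)) * (1 / real N * (- 2 * real N * tanh t))) (at t)"
      using DERIV_cmult[OF DERIV_fun_exp[OF DERIV_cdivide[OF DERIV_limit_profile[of N t], of "real N"]],
          of "2 * real N"] by (simp add: mult.assoc)
  qed
  have eps: "((\<lambda>b :: real. exp (- b)) \<longlongrightarrow> 0) at_top"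
    by (intro filterlim_compose[OF exp_at_bot] filterlim_uminus_at_bot_at_top)
  note lim = yang_family_limits[OF assms(1) sol]
  note conv = vortex_system_Ck_limit[OF sys sys0 eps lim]
  show "Ck_limit n (- {0}) (\<lambda>b z. exp (u b (ln (cmod z)) + b))
      (\<lambda>z. exp (limit_profile N (ln (cmod z)))) at_top"
    "Ck_limit n (- {0}) (\<lambda>b z. conf_factor N b (u b (ln (cmod z))))
      (\<lambda>z. 2 * real N * exp (limit_profile N (ln (cmod z)) / real N)) at_top"
    using conv by blast+
qed

section \<open>Convergence of the metrics\<close>

lemma dt_dtheta_sum:
  "dt_form z v * dt_form z w + dtheta_form z v * dtheta_form z w = Re (v * cnj w) / (cmod z)\<^sup>2"
proof -
  have "Re (x * cnj y) = Re x * Re y + Im x * Im y" for x y by simp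
  from this[of "v / z" "w / z", symmetric]
  have "dt_form z v * dt_form z w + dtheta_form z v * dtheta_form z w = Re (v / z * cnj (w / z))"
    by (simp only: dt_form_def dtheta_form_def)
  also have "v / z * cnj (w / z) = v * cnj w / of_real ((cmod z)\<^sup>2)"
    unfolding complex_norm_square by simp
  finally show ?thesis by (simp only: Re_divide_of_real)
qed

lemma inverse_cosh_ln:
  fixes r :: real
  assumes "r > 0"
  shows "1 / cosh (ln r) = 2 * r * inverse (1 + r\<^sup>2)"
  using assms by (simp add: cosh_ln_real power2_eq_square field_simps add_pos_pos)

lemma smooth_limit_on_subset:
  "smooth_limit_on A f l F \<Longrightarrow> K \<subseteq> A \<Longrightarrow> smooth_limit_on K f l F"
  unfolding smooth_limit_on_def using uniform_limit_on_subset by blast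

lemma smooth_limit_on_off_poles:
  assumes "\<And>n. Ck_limit n (- {0}) f l F" "compact K" "K \<subseteq> - {pt_zero, pt_infinity}"
  shows "smooth_limit_on {z. proj (lift U0 z) \<in> K} f l F"
proof -
  obtain A where "compact A" "A \<subseteq> - {0}" "{z. proj (lift U0 z) \<in> K} \<subseteq> A"
    using compact_off_poles_subset[OF assms(2,3)] .
  with smooth_limit_onI[OF assms(1)] smooth_limit_on_subset show ?thesis by blast
qed

lemma yang_metrics_converge:
  assumes "N \<ge> 1"
    and sol: "\<And>b. b > 0 \<Longrightarrow> yang_solution N b (u b)"
    and g: "\<And>b. b > 0 \<Longrightarrow> yang_metric N b (u b) (g b)"
  shows "metrics_converge_off_poles g (fubini_study (8 * real N)) at_top"
  unfolding metrics_converge_off_poles_def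
proof (intro allI impI, elim conjE)
  fix K v w assume "compact K" "K \<subseteq> - {pt_zero, pt_infinity}"
  let ?q = "\<lambda>z. dt_form z v * dt_form z w + dtheta_form z v * dtheta_form z w"
  have op: "open (- {0 :: complex})" by (rule open_Compl[OF closed_singleton])
  have "Ck_limit n (- {0}) (\<lambda>b z. local_tensor (g b) U0 z v w)
      (\<lambda>z. local_tensor (fubini_study (8 * real N)) U0 z v w) at_top" for n
  proof (rule Ck_limit_cong[OF op])
    show "Ck_limit n (- {0}) (\<lambda>b z. conf_factor N b (u b (ln (cmod z))) * ?q z)
        (\<lambda>z. 2 * real N * exp (limit_profile N (ln (cmod z)) / real N) * ?q z) at_top"
      by (intro Ck_limit_mult Ck_limit_add Ck_limit_dt_form Ck_limit_dtheta_form op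
          yang_family_Ck_limits(2) assms(1) sol)
    show "\<forall>\<^sub>F b in at_top. \<forall>z\<in>- {0}.
        conf_factor N b (u b (ln (cmod z))) * ?q z = local_tensor (g b) U0 z v w"
      using eventually_gt_at_top[of 0]
      by eventually_elim (use g in \<open>auto simp: yang_metric_def\<close>)
    fix z :: complex assume "z \<in> - {0}"
    then have "cmod z > 0" by simp
    have "exp (limit_profile N (ln (cmod z)) / real N) = (1 / cosh (ln (cmod z)))\<^sup>2"
      by (simp add: exp_limit_profile_div[OF assms(1)] power_divide)
    also have "\<dots> = 4 * (cmod z)\<^sup>2 * (fs_density z)\<^sup>2"
      unfolding inverse_cosh_ln[OF \<open>cmod z > 0\<close>] by (simp add: power_mult_distrib)
    finally show "2 * real N * exp (limit_profile N (ln (cmod z)) / real N) * ?q z =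
        local_tensor (fubini_study (8 * real N)) U0 z v w"
      using \<open>cmod z > 0\<close> unfolding dt_dtheta_sum local_tensor_fubini_study by simp
  qed
  then show "smooth_limit_on {z. proj (lift U0 z) \<in> K} (\<lambda>b z. local_tensor (g b) U0 z v w)
      (\<lambda>z. local_tensor (fubini_study (8 * real N)) U0 z v w) at_top"
    by (rule smooth_limit_on_off_poles) fact+
qed

lemma yang_hermitian_converge:
  assumes "N \<ge> 1"
    and sol: "\<And>b. b > 0 \<Longrightarrow> yang_solution N b (u b)"
    and h: "\<And>b. b > 0 \<Longrightarrow> yang_hermitian N (u b) (h b)"
  shows "bundle_metrics_converge_off_poles
    (\<lambda>b Z. inverse (SUP p. norm_sq (h b) (higgs N) p) * h b Z) (fubini_study_weight (2 * N)) at_top"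
  unfolding bundle_metrics_converge_off_poles_def
proof (intro allI impI, elim conjE)
  fix K assume "compact K" "K \<subseteq> - {pt_zero, pt_infinity}"
  let ?h = "\<lambda>b Z. inverse (SUP p. norm_sq (h b) (higgs N) p) * h b Z"
  let ?q = "\<lambda>z. (dt_form z 1 * dt_form z 1 + dtheta_form z 1 * dtheta_form z 1) ^ N"
  have q: "?q z = 1 / cmod z ^ (2 * N)" for z
    unfolding dt_dtheta_sum by (simp add: power_mult power_one_over)
  have op: "open (- {0 :: complex})" by (rule open_Compl[OF closed_singleton])
  have "Ck_limit n (- {0}) (\<lambda>b. local_weight (?h b) U0)
      (local_weight (fubini_study_weight (2 * N)) U0) at_top" for n
  proof (rule Ck_limit_cong[OF op])
    show "Ck_limit n (- {0}) (\<lambda>b z. exp (u b (ln (cmod z)) + b) * ?q z)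
        (\<lambda>z. exp (limit_profile N (ln (cmod z))) * ?q z) at_top"
      by (intro Ck_limit_mult Ck_limit_power Ck_limit_add Ck_limit_dt_form Ck_limit_dtheta_form op
          yang_family_Ck_limits(1) assms(1) sol)
    show "\<forall>\<^sub>F b in at_top. \<forall>z\<in>- {0}.
        exp (u b (ln (cmod z)) + b) * ?q z = local_weight (?h b) U0 z"
      using eventually_gt_at_top[of 0]
    proof eventually_elim
      case (elim b)
      have "local_weight (?h b) U0 z = inverse (exp (- b)) * local_weight (h b) U0 z" for z
        by (simp add: local_weight_def SUP_norm_sq_yang[OF assms(1) elim sol[OF elim] h[OF elim]])
      then show ?case
        using h[OF elim] by (auto simp: yang_hermitian_def q exp_add exp_minus)
    qed
    fix z :: complex assume "z \<in> - {0}"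
    then have "cmod z > 0" by simp
    have "exp (limit_profile N (ln (cmod z))) = (1 / cosh (ln (cmod z))) ^ (2 * N)"
      by (simp add: exp_limit_profile power_divide)
    also have "\<dots> = (2 * fs_density z) ^ (2 * N) * cmod z ^ (2 * N)"
      unfolding inverse_cosh_ln[OF \<open>cmod z > 0\<close>] by (simp add: power_mult_distrib)
    finally show "exp (limit_profile N (ln (cmod z))) * ?q z =
        local_weight (fubini_study_weight (2 * N)) U0 z"
      using \<open>cmod z > 0\<close> unfolding q local_weight_fubini_study by simp
  qed
  then show "smooth_limit_on {z. proj (lift U0 z) \<in> K} (\<lambda>b. local_weight (?h b) U0)
      (local_weight (fubini_study_weight (2 * N)) U0) at_top"
    by (rule smooth_limit_on_off_poles) fact+
qed

theorem mainTheorem5: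
  fixes N :: nat
    and u :: "real \<Rightarrow> real \<Rightarrow> real"
    and g :: "real \<Rightarrow> tensor2"
    and h :: "real \<Rightarrow> bundle_metric"
  assumes "N \<ge> 1"
    and "\<And>b. b > 0 \<Longrightarrow> yang_solution N b (u b)"
    and "\<And>b. b > 0 \<Longrightarrow> yang_metric N b (u b) (g b)"
    and "\<And>b. b > 0 \<Longrightarrow> yang_hermitian N (u b) (h b)"
  shows "(\<exists>g'. riemannian_metric g' \<and>
            (\<forall>c z v w. of_real (kaehler_form g' c z v w) = 4 * of_nat N * omega0 z v w) \<and>
            metrics_converge_off_poles g g' at_top)
       \<and> uniform_limit UNIV (\<lambda>b. norm_sq (h b) (higgs N)) (\<lambda>p. 0) at_top
       \<and> (\<exists>h'. hermitian_metric (2 * N) h' \<and>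
            (\<forall>c z v w. \<i> * curvature_form h' c z v w = 2 * of_nat N * omega0 z v w) \<and>
            bundle_metrics_converge_off_poles
              (\<lambda>b Z. inverse (SUP p. norm_sq (h b) (higgs N) p) * h b Z) h' at_top)"
proof (intro conjI exI[of _ "fubini_study (8 * real N)"] exI[of _ "fubini_study_weight (2 * N)"] allI)
  show "riemannian_metric (fubini_study (8 * real N))"
    using \<open>N \<ge> 1\<close> by (intro riemannian_metric_fubini_study) simp
  show "of_real (kaehler_form (fubini_study (8 * real N)) c z v w) = 4 * of_nat N * omega0 z v w"
    for c z v w
    using kaehler_form_fubini_study[of "4 * real N" c z v w] by simp
  show "metrics_converge_off_poles g (fubini_study (8 * real N)) at_top"
    by (rule yang_metrics_converge[OF assms(1-3)])
  have "\<forall>\<^sub>F b in at_top. \<forall>p\<in>UNIV. \<bar>norm_sq (h b) (higgs N) p - 0\<bar> \<le> 1 * exp (- b)"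
    using eventually_gt_at_top[of 0]
    by eventually_elim (use norm_sq_yang_le[OF assms(1) _ assms(2,4)] in auto)
  then show "uniform_limit UNIV (\<lambda>b. norm_sq (h b) (higgs N)) (\<lambda>p. 0) at_top"
    by (rule uniform_limit_exp_minus)
  show "hermitian_metric (2 * N) (fubini_study_weight (2 * N))"
    by (rule hermitian_metric_fubini_study_weight)
  show "\<i> * curvature_form (fubini_study_weight (2 * N)) c z v w = 2 * of_nat N * omega0 z v w"
    for c z v w
    by (simp add: curvature_form_fubini_study)
  show "bundle_metrics_converge_off_poles
      (\<lambda>b Z. inverse (SUP p. norm_sq (h b) (higgs N) p) * h b Z) (fubini_study_weight (2 * N)) at_top"
    by (rule yang_hermitian_converge[OF assms(1,2,4)])
qed

end
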